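(* Let $K$ be a field, let $K\subset L$ be a field extension, let $I$ be a 0-dimensional ideal in $P=K[x_1,\dots,x_n]$, and let $R=P/I$. Then the following conditions are equivalent. (a) The ring $R$ has the Cayley-Bacharach property. (b) The ring $R\otimes_KL\cong L[x_1,\dots,x_n]/I\,L[x_1,\dots,x_n]$ has the Cayley-Bacharach property.
   Context: Setting: $I$ is a proper ideal of $P=K[x_1,\dots,x_n]$ such that $\dim_K(P/I)<\infty$; $R=P/I$ is always considered with this fixed presentation, and $R\otimes_KL$ with the presentation $L[x_1,\dots,x_n]/I\,L[x_1,\dots,x_n]$ over the base field $L$. Degree filtration: $F_iP=\{f\in P\mid \deg f\le i\}\cup\{0\}$, $F_iI=F_iP\cap I$, and $F_iR=F_iP/F_iI$ is the image of $F_iP$ in $R$ ($i\in\mathbb Z$). $\mathrm{HF}^a_R(i)=\dim_K F_iR$. The regularity index is $\mathrm{ri}(R)=\min\{i\in\mathbb Z\mid \mathrm{HF}^a_R(j)=\dim_K R \text{ for all } j\ge i\}$. For $f\in R\setminus\{0\}$, $\mathrm{ord}_{\mathcal F}(f)=\min\{i\mid f\in F_iR\}$. Cayley-Bacharach property (CBP): let $I=\mathfrak Q_1\cap\dots\cap\mathfrak Q_s$ be the primary decomposition, $\mathfrak M_i=\mathrm{Rad}(\mathfrak Q_i)$ (maximal ideals), $\ell_i=\dim_K(P/\mathfrak M_i)$. A $\mathfrak Q_i$-divisor of $I$ is an ideal $J=\mathfrak Q_1\cap\dots\cap\mathfrak Q_i'\cap\dots\cap\mathfrak Q_s$ ($\mathfrak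 Q_i$ replaced by $\mathfrak Q_i'$), where $\mathfrak Q_i'$ is an ideal of $P$ with $\mathfrak Q_i\subsetneq\mathfrak Q_i'$ (so $\mathfrak Q_i'\subseteq\mathfrak M_i$ or $\mathfrak Q_i'=P$). It is minimal if $\dim_K(J/I)=\ell_i$. For a minimal $\mathfrak Q_i$-divisor $J$ with image $\bar J=J/I$ in $R$, put $\mathrm{ri}(\bar J)=\max\{\mathrm{ord}_{\mathcal F}(f)\mid f\in\bar J\setminus\{0\}\}$. $R$ has the CBP if for every $i\in\{1,\dots,s\}$ and every minimal $\mathfrak Q_i$-divisor $J$ of $I$ we have $\mathrm{ri}(\bar J)=\mathrm{ri}(R)$. *)

theory Defs
  imports "HOL-Algebra.Algebra" "HOL-Algebra.Algebraic_Closure_Type" "HOL-Library.Poly_Mapping"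
begin

section \<open>Polynomial rings in the variables indexed by a finite type\<close>

text \<open>Polynomials are finitely supported maps from exponent vectors to coefficients; the product
  of the library is the convolution product. All coefficients live in one ambient field, given as a
  type, and the base field \<open>K\<close> is a subfield of it. Thus \<open>mpoly_ring K\<close> and \<open>mpoly_ring UNIV\<close> are
  \<open>K[x\<^sub>1,\<dots>,x\<^sub>n]\<close> and \<open>L[x\<^sub>1,\<dots>,x\<^sub>n]\<close>, the former being a subring of the latter.\<close>

type_synonym ('x, 'a) mpoly = "('x \<Rightarrow>\<^sub>0 nat) \<Rightarrow>\<^sub>0 'a"

definition mpoly_ring :: "'a::field set \<Rightarrow> ('x, 'a) mpoly ring" where
  "mpoly_ring K = ring_of_type_algebra\<lparr>carrier := {f. \<forall>m. Poly_Mapping.lookup f m \<in> K}\<rparr>"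

definition mon_deg :: "('x \<Rightarrow>\<^sub>0 nat) \<Rightarrow> nat" where
  "mon_deg m = (\<Sum>x\<in>Poly_Mapping.keys m. Poly_Mapping.lookup m x)"

definition tot_deg :: "('x, 'a::zero) mpoly \<Rightarrow> nat" where
  "tot_deg f = Max (mon_deg ` Poly_Mapping.keys f)"  \<comment> \<open>only meaningful for \<open>f \<noteq> 0\<close>\<close>

definition poly_filt :: "'a::field set \<Rightarrow> int \<Rightarrow> ('x, 'a) mpoly set" where
  "poly_filt K i = {f \<in> carrier (mpoly_ring K). f \<noteq> 0 \<and> int (tot_deg f) \<le> i} \<union> {0}"


section \<open>The residue class ring \<open>R = P/I\<close> with its degree filtration\<close>

abbreviation quot_ring :: "'a::field set \<Rightarrow> ('x, 'a) mpoly set \<Rightarrow> ('x, 'a) mpoly set ring" where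
  "quot_ring K I \<equiv> mpoly_ring K Quot I"

text \<open>The image in \<open>R\<close> of a set of polynomials; for \<open>I \<subseteq> J\<close> this is \<open>J/I\<close>.\<close>

definition quot_img :: "'a::field set \<Rightarrow> ('x, 'a) mpoly set \<Rightarrow> ('x, 'a) mpoly set
    \<Rightarrow> ('x, 'a) mpoly set set" where
  "quot_img K I J = (\<lambda>f. I +>\<^bsub>mpoly_ring K\<^esub> f) ` J"

text \<open>The base field as a subfield of \<open>R\<close>, over which dimensions are taken
  (\<open>I\<close> is proper wherever this is used).\<close>

definition quot_scalars :: "'a::field set \<Rightarrow> ('x, 'a) mpoly set \<Rightarrow> ('x, 'a) mpoly set set" where
  "quot_scalars K I = quot_img K I (Poly_Mapping.single 0 ` K)"

definition quot_dim :: "'a::field set \<Rightarrow> ('x, 'a) mpoly set \<Rightarrow> ('x, 'a) mpoly set set \<Rightarrow> nat" where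
  "quot_dim K I E = ring.dim (quot_ring K I) (quot_scalars K I) E"

definition zero_dimensional :: "'a::field set \<Rightarrow> ('x, 'a) mpoly set \<Rightarrow> bool" where
  "zero_dimensional K I \<longleftrightarrow>
     ideal I (mpoly_ring K) \<and> I \<noteq> carrier (mpoly_ring K) \<and>
     ring.finite_dimension (quot_ring K I) (quot_scalars K I) (carrier (quot_ring K I))"

definition quot_filt :: "'a::field set \<Rightarrow> ('x, 'a) mpoly set \<Rightarrow> int \<Rightarrow> ('x, 'a) mpoly set set" where
  "quot_filt K I i = quot_img K I (poly_filt K i)"

definition affine_HF :: "'a::field set \<Rightarrow> ('x, 'a) mpoly set \<Rightarrow> int \<Rightarrow> nat" where
  "affine_HF K I i = quot_dim K I (quot_filt K I i)"

definition reg_index :: "'a::field set \<Rightarrow> ('x, 'a) mpoly set \<Rightarrow> int" where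
  "reg_index K I = (LEAST i. \<forall>j\<ge>i. affine_HF K I j = quot_dim K I (carrier (quot_ring K I)))"

definition filt_ord :: "'a::field set \<Rightarrow> ('x, 'a) mpoly set \<Rightarrow> ('x, 'a) mpoly set \<Rightarrow> int" where
  "filt_ord K I f = (LEAST i. f \<in> quot_filt K I i)"

text \<open>The regularity index of an ideal \<open>J/I\<close> of \<open>R\<close>, in terms of \<open>J\<close>.\<close>

definition reg_index_ideal :: "'a::field set \<Rightarrow> ('x, 'a) mpoly set \<Rightarrow> ('x, 'a) mpoly set \<Rightarrow> int" where
  "reg_index_ideal K I J = Max (filt_ord K I ` (quot_img K I J - {\<zero>\<^bsub>quot_ring K I\<^esub>}))"


section \<open>Primary decompositions\<close>

definition ideal_radical :: "('r, 'm) ring_scheme \<Rightarrow> 'r set \<Rightarrow> 'r set" where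
  "ideal_radical R Q = {f \<in> carrier R. \<exists>k::nat. f [^]\<^bsub>R\<^esub> k \<in> Q}"

definition primary_ideal :: "'r set \<Rightarrow> ('r, 'm) ring_scheme \<Rightarrow> bool" where
  "primary_ideal Q R \<longleftrightarrow>
     ideal Q R \<and> Q \<noteq> carrier R \<and>
     (\<forall>a\<in>carrier R. \<forall>b\<in>carrier R. a \<otimes>\<^bsub>R\<^esub> b \<in> Q \<longrightarrow> a \<in> Q \<or> b \<in> ideal_radical R Q)"

text \<open>Minimal primary decompositions \<open>I = Q\<^sub>1 \<inter> \<dots> \<inter> Q\<^sub>s\<close>. Intersecting with the carrier only
  affects empty intersections.\<close>

definition primary_decomposition ::
    "('r, 'm) ring_scheme \<Rightarrow> 'r set \<Rightarrow> nat \<Rightarrow> (nat \<Rightarrow> 'r set) \<Rightarrow> bool" where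
  "primary_decomposition R I s Q \<longleftrightarrow>
     (\<forall>i\<in>{1..s}. primary_ideal (Q i) R) \<and>
     I = carrier R \<inter> (\<Inter>i\<in>{1..s}. Q i) \<and>
     inj_on (\<lambda>i. ideal_radical R (Q i)) {1..s} \<and>
     (\<forall>i\<in>{1..s}. \<not> carrier R \<inter> (\<Inter>j\<in>{1..s} - {i}. Q j) \<subseteq> Q i)"


section \<open>The Cayley-Bacharach property\<close>

definition primary_divisor ::
    "('r, 'm) ring_scheme \<Rightarrow> nat \<Rightarrow> (nat \<Rightarrow> 'r set) \<Rightarrow> nat \<Rightarrow> 'r set \<Rightarrow> bool" where
  "primary_divisor R s Q i J \<longleftrightarrow>
     (\<exists>Q'. ideal Q' R \<and> Q i \<subset> Q' \<and> J = (\<Inter>j\<in>{1..s}. (Q(i := Q')) j))"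

definition minimal_primary_divisor ::
    "'a::field set \<Rightarrow> ('x, 'a) mpoly set \<Rightarrow> nat \<Rightarrow> (nat \<Rightarrow> ('x, 'a) mpoly set) \<Rightarrow> nat
     \<Rightarrow> ('x, 'a) mpoly set \<Rightarrow> bool" where
  "minimal_primary_divisor K I s Q i J \<longleftrightarrow>
     primary_divisor (mpoly_ring K) s Q i J \<and>
     (let M = ideal_radical (mpoly_ring K) (Q i)
      in quot_dim K I (quot_img K I J) = quot_dim K M (carrier (quot_ring K M)))"

text \<open>For a zero-dimensional \<open>I\<close> all associated primes are maximal, so the minimal primary
  decomposition exists and is unique up to the order of its components.\<close>

definition cayley_bacharach :: "'a::field set \<Rightarrow> ('x, 'a) mpoly set \<Rightarrow> bool" where
  "cayley_bacharach K I \<longleftrightarrow>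
     (\<exists>s Q. primary_decomposition (mpoly_ring K) I s Q \<and>
        (\<forall>i\<in>{1..s}. \<forall>J. minimal_primary_divisor K I s Q i J \<longrightarrow>
           reg_index_ideal K I J = reg_index K I))"

end

theory Submission
  imports Defs
begin

text \<open>The minimal divisors of \<open>I\<close> are the preimages of the minimal nonzero ideals of \<open>R\<close>, and such an
  ideal has regularity index \<open>ri(R)\<close> unless it lies in \<open>F\<^sub>r R\<close> for \<open>r = ri(R) - 1\<close>. Since every nonzero ideal
  of \<open>R\<close> contains a minimal one, \<open>R\<close> has the Cayley-Bacharach property iff \<open>F\<^sub>r R\<close> contains no nonzero
  ideal, i.e. iff there is no \<open>f \<notin> I\<close> with \<open>f P \<subseteq> F\<^sub>r P + I\<close>. This condition no longer mentions
  primary components. It is compatible with base change: a \<open>K\<close>-linear retraction \<open>\<phi>: L \<rightarrow> K\<close>, applied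
  coefficientwise, is a \<open>K[x]\<close>-linear map that sends the \<open>L\<close>-span of a \<open>K\<close>-subspace \<open>V\<close> of \<open>K[x]\<close> back to
  \<open>V\<close>, and a polynomial outside \<open>I L[x]\<close> has a scalar multiple that is mapped outside \<open>I\<close>.\<close>

section \<open>Linear retractions onto a subfield\<close>

text \<open>Components cannot be compared directly: a maximal ideal of \<open>K[x]\<close> may split
  over \<open>L\<close>, or its residue ring become non-reduced, so neither the components nor the
  numbers l_i are stable under the extension. The value ri(R) - 1 enters because no nonzero element
  of R has order above ri(R), so the maximum of the orders on J/I misses ri(R) exactly when all of
  them are at most ri(R) - 1. Two facts connect divisors with ideals: a minimal divisor properly
  contains \<open>I\<close>, and a minimal nonzero ideal of R is generated by one class j, hence
  isomorphic to P/(I : j) with I : j maximal, which makes it a minimal divisor for every minimal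
  primary decomposition. Chain conditions are replaced by dimension counts: the dimension of V/I
  grows strictly with V. Since L over K may have infinite degree, a single functional is used
  instead of coordinates. It sees only one coordinate and may kill an element outside I L[x];
  scaling the element beforehand brings the other coordinates into view.\<close>

lemma subfield_type_algebra:
  fixes K :: "'l::field set"
  assumes "subfield K (ring_of_type_algebra :: 'l ring)"
  shows "0 \<in> K" "1 \<in> K" "\<And>a b. a \<in> K \<Longrightarrow> b \<in> K \<Longrightarrow> a + b \<in> K"
    "\<And>a b. a \<in> K \<Longrightarrow> b \<in> K \<Longrightarrow> a * b \<in> K" "\<And>a. a \<in> K \<Longrightarrow> - a \<in> K"
    "\<And>a. a \<in> K \<Longrightarrow> inverse a \<in> K"
proof -
  let ?R = "ring_of_type_algebra :: 'l ring"
  interpret R: field ?R by (rule field_from_type_algebra)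
  note K = subringE[OF subfieldE(1)[OF assms]]
  show "0 \<in> K" "1 \<in> K" using K(2,3) by (simp_all add: ring_of_type_algebra_def)
  show "a + b \<in> K" if "a \<in> K" "b \<in> K" for a b
    using K(7)[OF that] by (simp add: ring_of_type_algebra_def)
  show "a * b \<in> K" if "a \<in> K" "b \<in> K" for a b
    using K(6)[OF that] by (simp add: ring_of_type_algebra_def)
  show "- a \<in> K" if "a \<in> K" for a
  proof -
    have "\<ominus>\<^bsub>?R\<^esub> a = - a"
      by (rule R.minus_equality) (simp_all add: ring_of_type_algebra_def)
    then show ?thesis using K(5)[OF that] by simp
  qed
  show "inverse a \<in> K" if "a \<in> K" for a
  proof (cases "a = 0")
    case False
    then have a: "a \<in> K - {\<zero>\<^bsub>?R\<^esub>}" using that by (simp add: ring_of_type_algebra_def)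
    have "a * (inv\<^bsub>?R\<^esub> a) = 1"
      using R.subfield_m_inv(2)[OF assms a] by (simp add: ring_of_type_algebra_def)
    then have "inv\<^bsub>?R\<^esub> a = inverse a" by (simp add: inverse_unique)
    then show ?thesis using R.subfield_m_inv(1)[OF assms a] by simp
  qed (use \<open>0 \<in> K\<close> in simp)
qed

text \<open>The kernel of \<open>\<phi>\<close> is a maximal \<open>K\<close>-subspace not containing 1.\<close>

lemma linear_retraction:
  fixes K :: "'l::field set"
  assumes "subfield K (ring_of_type_algebra :: 'l ring)"
  obtains \<phi> :: "'l \<Rightarrow> 'l" where "\<And>a. \<phi> a \<in> K" "\<And>a b. \<phi> (a + b) = \<phi> a + \<phi> b"
    "\<And>k a. k \<in> K \<Longrightarrow> \<phi> (k * a) = k * \<phi> a" "\<phi> 1 = 1"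
proof -
  note K = subfield_type_algebra[OF assms]
  define S where "S = {W :: 'l set. 0 \<in> W \<and> 1 \<notin> W \<and> (\<forall>a\<in>W. \<forall>b\<in>W. a + b \<in> W) \<and> (\<forall>k\<in>K. \<forall>a\<in>W. k * a \<in> W)}"
  have "\<exists>W\<in>S. \<forall>Z\<in>S. W \<subseteq> Z \<longrightarrow> Z = W"
  proof (rule subset_Zorn_nonempty)
    show "S \<noteq> {}" by (auto simp: S_def intro!: exI[of _ "{0}"])
    fix \<C> assume C: "\<C> \<noteq> {}" "subset.chain S \<C>"
    then have sub: "\<C> \<subseteq> S" and ch: "\<And>A B. A \<in> \<C> \<Longrightarrow> B \<in> \<C> \<Longrightarrow> A \<subseteq> B \<or> B \<subseteq> A"
      by (auto simp: subset_chain_def)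
    have "a + b \<in> \<Union>\<C>" if "a \<in> \<Union>\<C>" "b \<in> \<Union>\<C>" for a b
    proof -
      from that obtain A B where "a \<in> A" "A \<in> \<C>" "b \<in> B" "B \<in> \<C>" by blast
      with ch[of A B] obtain D where "D \<in> \<C>" "a \<in> D" "b \<in> D" by blast
      with sub show ?thesis by (auto simp: S_def)
    qed
    moreover have "0 \<in> \<Union>\<C>" using C(1) sub unfolding S_def by blast
    moreover have "1 \<notin> \<Union>\<C>" "\<forall>k\<in>K. \<forall>a\<in>\<Union>\<C>. k * a \<in> \<Union>\<C>" using sub unfolding S_def by blast+
    ultimately show "\<Union>\<C> \<in> S" unfolding S_def by blast
  qed
  then obtain W where W: "W \<in> S" and max: "\<And>Z. Z \<in> S \<Longrightarrow> W \<subseteq> Z \<Longrightarrow> Z = W" by blast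
  have W0: "0 \<in> W" and W1: "1 \<notin> W" and Wadd: "\<And>a b. a \<in> W \<Longrightarrow> b \<in> W \<Longrightarrow> a + b \<in> W"
    and Wmult: "\<And>k a. k \<in> K \<Longrightarrow> a \<in> W \<Longrightarrow> k * a \<in> W" using W by (auto simp: S_def)
  have Wdiff: "a - b \<in> W" if "a \<in> W" "b \<in> W" for a b
    using Wadd[OF that(1) Wmult[OF K(5)[OF K(2)] that(2)]] by simp
  \<comment> \<open>Together with \<open>uniq\<close> this says that the ambient field is the direct
    sum of \<open>K\<close> and \<open>W\<close>; \<open>\<phi>\<close> is then the projection to
    \<open>K\<close> along \<open>W\<close>.\<close>
  have ex: "\<exists>k\<in>K. x - k \<in> W" for x
  proof (cases "x \<in> W")
    case True then show ?thesis using K(1) by (intro bexI[of _ 0]) simp_all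
  next
    case False
    define Z where "Z = {w + k * x | w k. w \<in> W \<and> k \<in> K}"
    have "x = 0 + 1 * x" by simp
    then have "x \<in> Z" unfolding Z_def using W0 K(2) by blast
    then have "Z \<noteq> W" using False by blast
    moreover have "W \<subseteq> Z"
    proof
      fix w assume "w \<in> W"
      moreover have "w = w + 0 * x" by simp
      ultimately show "w \<in> Z" unfolding Z_def using K(1) by blast
    qed
    ultimately have "Z \<notin> S" using max by blast
    moreover have "0 \<in> Z" using \<open>W \<subseteq> Z\<close> W0 by blast
    moreover have "a + b \<in> Z" if ab: "a \<in> Z" "b \<in> Z" for a b
    proof -
      from ab obtain w k w' k' where "w \<in> W" "k \<in> K" "a = w + k * x" "w' \<in> W" "k' \<in> K" "b = w' + k' * x"
        by (auto simp: Z_def)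
      moreover from this have "a + b = (w + w') + (k + k') * x" by (simp add: algebra_simps)
      ultimately show ?thesis unfolding Z_def using Wadd K(3) by blast
    qed
    moreover have "c * a \<in> Z" if "c \<in> K" "a \<in> Z" for c a
    proof -
      from that obtain w k where "w \<in> W" "k \<in> K" "a = w + k * x" by (auto simp: Z_def)
      moreover from this have "c * a = c * w + (c * k) * x" by (simp add: algebra_simps)
      ultimately show ?thesis unfolding Z_def using Wmult K(4) \<open>c \<in> K\<close> by blast
    qed
    ultimately have "1 \<in> Z" by (auto simp: S_def)
    \<comment> \<open>Since 1 is not in \<open>W\<close>, the scalar \<open>k\<close> is nonzero,
      and solving for \<open>x\<close> gives \<open>inverse k\<close> as its representative modulo
      \<open>W\<close>.\<close>
    then obtain w k where wk: "w \<in> W" "k \<in> K" "1 = w + k * x" by (auto simp: Z_def)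
    then have "k \<noteq> 0" using W1 by auto
    have "- inverse k * w \<in> W" using wk K(5,6) Wmult by blast
    moreover have "- inverse k * w = x - inverse k"
      using \<open>k \<noteq> 0\<close> wk(3) by (simp add: field_simps)
    ultimately show ?thesis using K(6) wk(2) by auto
  qed
  have uniq: "k = k'" if "k \<in> K" "k' \<in> K" "x - k \<in> W" "x - k' \<in> W" for x k k'
  proof (rule ccontr)
    assume "k \<noteq> k'"
    have "k' - k \<in> W" using Wdiff[OF that(3,4)] by simp
    moreover have "inverse (k' - k) \<in> K" using that K(3,5,6) by (metis add_uminus_conv_diff)
    ultimately have "inverse (k' - k) * (k' - k) \<in> W" using Wmult by blast
    then show False using W1 \<open>k \<noteq> k'\<close> by simp
  qed
  from ex obtain \<phi> where phi: "\<And>x. \<phi> x \<in> K" "\<And>x. x - \<phi> x \<in> W" by metis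
  show ?thesis
  proof
    show "\<phi> a \<in> K" for a by (rule phi)
    show "\<phi> (a + b) = \<phi> a + \<phi> b" for a b
      using Wadd[OF phi(2)[of a] phi(2)[of b]]
      by (intro uniq[of _ _ "a + b"] phi K) (simp_all add: algebra_simps)
    show "\<phi> (k * a) = k * \<phi> a" if "k \<in> K" for k a
      using Wmult[OF that phi(2)[of a]]
      by (intro uniq[of _ _ "k * a"] phi K that) (simp_all add: algebra_simps)
    show "\<phi> 1 = 1" by (intro uniq[of _ _ 1] phi K) (use W0 in simp)
  qed
qed

section \<open>The polynomial rings\<close>

lemma poly_mapping_sum_single:
  fixes f :: "'a \<Rightarrow>\<^sub>0 'b::comm_monoid_add"
  shows "f = (\<Sum>m\<in>Poly_Mapping.keys f. Poly_Mapping.single m (Poly_Mapping.lookup f m))"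
  by (rule poly_mapping_eqI)
    (auto simp: lookup_sum lookup_single when_def in_keys_iff)

text \<open>The monomial case mentions only coefficients of \<open>f\<close> itself. Hence a fact
  such as "all coefficients of \<open>f\<close> lie in \<open>K\<close>" can be used there without
  being carried through \<open>P\<close>.\<close>

lemma poly_mapping_additive_induct [case_names zero add single]:
  fixes f :: "'a \<Rightarrow>\<^sub>0 'b::comm_monoid_add"
  assumes "P 0" "\<And>f g. P f \<Longrightarrow> P g \<Longrightarrow> P (f + g)" "\<And>m. P (Poly_Mapping.single m (Poly_Mapping.lookup f m))"
  shows "P f"
proof -
  have "P (\<Sum>m\<in>Z. Poly_Mapping.single m (Poly_Mapping.lookup f m))" if "finite Z" for Z
    using that by (induction Z) (auto intro: assms)
  from this[of "Poly_Mapping.keys f"] show ?thesis using poly_mapping_sum_single[of f] by simp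
qed

lemma mpoly_ring_simps [simp]:
  "f \<in> carrier (mpoly_ring K) \<longleftrightarrow> (\<forall>m. Poly_Mapping.lookup f m \<in> K)"
  "monoid.mult (mpoly_ring K) = (*)" "add (mpoly_ring K) = (+)"
  "\<one>\<^bsub>mpoly_ring K\<^esub> = 1" "\<zero>\<^bsub>mpoly_ring K\<^esub> = 0"
  by (simp_all add: mpoly_ring_def ring_of_type_algebra_def fun_eq_iff)

text \<open>Additivity in each factor reduces the claim to a product of two monomials, so the
  convolution sum is never unfolded.\<close>

lemma lookup_mult_mem:
  fixes f g :: "('x, 'a::field) mpoly"
  assumes K: "0 \<in> K" "\<And>a b. a \<in> K \<Longrightarrow> b \<in> K \<Longrightarrow> a + b \<in> K" "\<And>a b. a \<in> K \<Longrightarrow> b \<in> K \<Longrightarrow> a * b \<in> K"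
    and f: "\<And>m. Poly_Mapping.lookup f m \<in> K" and g: "\<And>m. Poly_Mapping.lookup g m \<in> K"
  shows "Poly_Mapping.lookup (f * g) m \<in> K"
proof -
  have "\<forall>k. Poly_Mapping.lookup (f * g) k \<in> K"
  proof (induction f rule: poly_mapping_additive_induct)
    case (single m)
    show ?case
    proof (induction g rule: poly_mapping_additive_induct)
      case (single n)
      then show ?case using f g K by (simp add: mult_single lookup_single when_def)
    qed (use K in \<open>auto simp: lookup_add distrib_left\<close>)
  qed (use K in \<open>auto simp: lookup_add distrib_right\<close>)
  then show ?thesis by blast
qed

abbreviation cst :: "'a::zero \<Rightarrow> ('x, 'a) mpoly" where "cst \<equiv> Poly_Mapping.single 0"

lemma mpoly_ring_cring:
  fixes K :: "'l::field set"
  assumes "subfield K (ring_of_type_algebra :: 'l ring)"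
  shows "cring (mpoly_ring K :: ('x, 'l) mpoly ring)"
proof -
  note K = subfield_type_algebra[OF assms]
  let ?P = "mpoly_ring K :: ('x, 'l) mpoly ring"
  have neg: "\<exists>g\<in>carrier ?P. g + f = 0" if "f \<in> carrier ?P" for f
    using that K(5) by (intro bexI[of _ "- f"]) simp_all
  show ?thesis
  proof (rule cringI)
    show "abelian_group ?P"
      using neg by (intro abelian_groupI) (simp_all add: lookup_add K add_ac)
    show "Group.comm_monoid ?P"
      by (intro comm_monoidI) (simp_all add: lookup_mult_mem K lookup_one when_def mult_ac)
  qed (simp add: distrib_right)
qed

lemma subfield_constants:
  fixes K :: "'l::field set"
  assumes "subfield K (ring_of_type_algebra :: 'l ring)"
  shows "subfield (cst ` K) (mpoly_ring K :: ('x, 'l) mpoly ring)"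
proof -
  note K = subfield_type_algebra[OF assms]
  let ?R = "ring_of_type_algebra :: 'l ring" and ?P = "mpoly_ring K :: ('x, 'l) mpoly ring"
  interpret R: field ?R by (rule field_from_type_algebra)
  interpret KR: field "?R\<lparr>carrier := K\<rparr>" by (rule R.subfield_iff(2)[OF assms])
  interpret P: cring ?P by (rule mpoly_ring_cring[OF assms])
  interpret h: ring_hom_ring "?R\<lparr>carrier := K\<rparr>" ?P cst
    by (intro ring_hom_ringI KR.ring_axioms P.ring_axioms)
      (simp_all add: ring_of_type_algebra_def lookup_single when_def K mult_single single_add)
  show ?thesis
    using h.img_is_subfield(2)[OF KR.carrier_is_subfield] by simp
qed

text \<open>Bounding every monomial separately absorbs the exceptional role of 0 and the maximum in
  \<open>tot_deg\<close>. In this form closure under sums and under coefficientwise maps is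
  immediate.\<close>

lemma poly_filt_eq:
  fixes K :: "'a::field set"
  assumes "0 \<in> K"
  shows "(poly_filt K i :: ('x, 'a) mpoly set) = {f \<in> carrier (mpoly_ring K). \<forall>m\<in>Poly_Mapping.keys f. int (mon_deg m) \<le> i}"
proof -
  have "int (tot_deg f) \<le> i \<longleftrightarrow> (\<forall>m\<in>Poly_Mapping.keys f. int (mon_deg m) \<le> i)" if "f \<noteq> 0" for f :: "('x, 'a) mpoly"
  proof -
    have "int (tot_deg f) \<le> i \<longleftrightarrow> 0 \<le> i \<and> tot_deg f \<le> nat i" by linarith
    also have "\<dots> \<longleftrightarrow> 0 \<le> i \<and> (\<forall>m\<in>Poly_Mapping.keys f. mon_deg m \<le> nat i)"
      unfolding tot_deg_def using \<open>f \<noteq> 0\<close> by (subst Max_le_iff) auto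
    also have "\<dots> \<longleftrightarrow> (\<forall>m\<in>Poly_Mapping.keys f. int (mon_deg m) \<le> i)"
    proof -
      \<comment> \<open>For negative \<open>i\<close> the right-hand side must fail, and only an
        actual monomial can refute it.\<close>
      obtain m where "m \<in> Poly_Mapping.keys f" using \<open>f \<noteq> 0\<close> by (metis keys_eq_empty ex_in_conv)
      then show ?thesis by (metis int_nat_eq nat_le_iff nat_int of_nat_0_le_iff order_trans zle_int)
    qed
    finally show ?thesis .
  qed
  then show ?thesis using assms by (auto simp: poly_filt_def)
qed

lemma ideal_mpoly_ring_iff:
  fixes K :: "'l::field set" and J :: "('x, 'l) mpoly set"
  assumes "subfield K (ring_of_type_algebra :: 'l ring)"
  shows "ideal J (mpoly_ring K) \<longleftrightarrow> J \<subseteq> carrier (mpoly_ring K) \<and> 0 \<in> J \<and>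
    (\<forall>f\<in>J. \<forall>g\<in>J. f + g \<in> J) \<and> (\<forall>f\<in>J. \<forall>g\<in>carrier (mpoly_ring K). f * g \<in> J)" (is "?l \<longleftrightarrow> ?r")
proof -
  note K = subfield_type_algebra[OF assms]
  let ?P = "mpoly_ring K :: ('x, 'l) mpoly ring"
  interpret P: cring ?P by (rule mpoly_ring_cring[OF assms])
  show ?thesis
  proof
    assume ?l
    then interpret ideal J ?P .
    show ?r using a_subset zero_closed a_closed I_r_closed by simp
  next
    assume r: ?r
    have neg: "\<ominus>\<^bsub>?P\<^esub> f = - f" if "f \<in> carrier ?P" for f
      using that by (intro P.minus_equality) (auto simp: K)
    have "- f \<in> J" if "f \<in> J" for f
    proof -
      have "- 1 \<in> carrier ?P" by (simp add: K lookup_one when_def)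
      with r that have "f * (- 1) \<in> J" by blast
      then show ?thesis by simp
    qed
    then show ?l using r neg
      by (intro idealI P.ring_axioms P.add.subgroupI)
        (force simp: mult.commute simp flip: a_inv_def)+
  qed
qed

section \<open>Quotients of finite dimension\<close>

declare mpoly_ring_simps(1) [simp del] ring.Span.simps [simp del]

text \<open>Along a construction of \<open>E\<close> by line extensions, injectivity keeps the image
  of each new vector outside the image of the previous space. The map \<open>h\<close> is merely
  additive and the scalars correspond only through their action, so that multiplication by a fixed
  element, which is no ring homomorphism, is covered.\<close>

lemma (in ring) dimension_transfer:
  assumes S: "ring S" and k: "subfield k R" and k': "k' \<subseteq> carrier S"
    and h: "\<And>x. x \<in> carrier R \<Longrightarrow> h x \<in> carrier S" "inj_on h (carrier R)"
    and add: "\<And>x y. x \<in> carrier R \<Longrightarrow> y \<in> carrier R \<Longrightarrow> h (x \<oplus> y) = h x \<oplus>\<^bsub>S\<^esub> h y"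
    and smult: "\<And>a. a \<in> k \<Longrightarrow> \<exists>b\<in>k'. \<forall>x\<in>carrier R. h (a \<otimes> x) = b \<otimes>\<^bsub>S\<^esub> h x"
      "\<And>b. b \<in> k' \<Longrightarrow> \<exists>a\<in>k. \<forall>x\<in>carrier R. h (a \<otimes> x) = b \<otimes>\<^bsub>S\<^esub> h x"
    and dim: "dimension n k E"
  shows "ring.dimension S n k' (h ` E)"
proof -
  interpret S: ring S by fact
  have kR: "k \<subseteq> carrier R" using subfieldE(3)[OF k] .
  show ?thesis using dim
  proof (induction n arbitrary: E)
    case 0
    have "h \<zero> \<oplus>\<^bsub>S\<^esub> h \<zero> = h \<zero>" using add[of \<zero> \<zero>] by simp
    then have "h \<zero> = \<zero>\<^bsub>S\<^esub>" using h(1)[of \<zero>] S.add.l_cancel_one by simp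
    then show ?case using dimension_zero[OF k 0] by auto
  next
    case (Suc n)
    obtain v E' where v: "v \<in> carrier R" "v \<notin> E'" and dim: "dimension n k E'"
      and E: "E = line_extension k v E'"
      using dimension_backwards[OF k Suc.prems] by blast
    note E' = space_subgroup_props(1)[OF k dim]
    have "h v \<notin> h ` E'" using v E' h(2) by (auto dest: inj_onD)
    then have "S.dimension (Suc n) k' (S.line_extension k' (h v) (h ` E'))"
      using Suc.IH[OF dim] h(1) v(1) by (intro S.Suc_dim)
    moreover have "h ` E = S.line_extension k' (h v) (h ` E')"
    proof safe
      fix u assume "u \<in> E"
      then obtain a w where aw: "a \<in> k" "w \<in> E'" "u = a \<otimes> v \<oplus> w"
        unfolding E line_extension_mem_iff by blast
      obtain b where "b \<in> k'" "h (a \<otimes> v) = b \<otimes>\<^bsub>S\<^esub> h v" using smult(1)[OF aw(1)] v(1) by blast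
      moreover have "h u = h (a \<otimes> v) \<oplus>\<^bsub>S\<^esub> h w"
        using aw kR E' v(1) by (auto intro!: add)
      ultimately show "h u \<in> S.line_extension k' (h v) (h ` E')"
        unfolding S.line_extension_mem_iff using aw(2) by auto
    next
      fix u assume "u \<in> S.line_extension k' (h v) (h ` E')"
      then obtain b w where bw: "b \<in> k'" "w \<in> E'" "u = b \<otimes>\<^bsub>S\<^esub> h v \<oplus>\<^bsub>S\<^esub> h w"
        unfolding S.line_extension_mem_iff by blast
      obtain a where a: "a \<in> k" "h (a \<otimes> v) = b \<otimes>\<^bsub>S\<^esub> h v" using smult(2)[OF bw(1)] v(1) by blast
      then have "h (a \<otimes> v \<oplus> w) = u"
        using bw kR E' v(1) by (subst add) auto
      moreover have "a \<otimes> v \<oplus> w \<in> E" unfolding E line_extension_mem_iff using a bw by blast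
      ultimately show "u \<in> h ` E" by blast
    qed
    ultimately show ?case by simp
  qed
qed

text \<open>With equal dimensions a basis of \<open>E\<close> would be an independent list of full
  length in \<open>F\<close>, and so would span \<open>F\<close>.\<close>

lemma (in ring) dim_mono_strict:
  assumes k: "subfield k R" and F: "finite_dimension k F" and E: "subalgebra k E R" and EF: "E \<subset> F"
  shows "(dim over k) E < (dim over k) F"
proof -
  have fE: "finite_dimension k E" using subalbegra_incl_imp_finite_dimension[OF k F E] EF by blast
  obtain Us where Us: "independent k Us" "length Us = (dim over k) E" "Span k Us = E" "set Us \<subseteq> carrier R"
    using exists_base[OF k finite_dimensionE[OF k fE]] by blast
  have "set Us \<subseteq> F" using Span_base_incl[OF k Us(4)] Us(3) EF by blast
  then show ?thesis
    using independent_length_le_dimension[OF k finite_dimensionE[OF k F] Us(1)]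
      independent_length_eq_dimension[OF k finite_dimensionE[OF k F] Us(1)] Us(2,3) EF
    by fastforce
qed

text \<open>The integers are not well-ordered, so the minimum is first taken over the natural
  numbers; \<open>neg\<close> guarantees that nothing is lost. Every later use of
  \<open>reg_index\<close> and \<open>filt_ord\<close> goes through this threshold form.\<close>

lemma Least_int_le_iff:
  fixes P :: "int \<Rightarrow> bool"
  assumes mono: "\<And>i j. P i \<Longrightarrow> i \<le> j \<Longrightarrow> P j" and neg: "\<And>i. i < 0 \<Longrightarrow> \<not> P i" and ex: "P i"
  shows "(LEAST i. P i) \<le> j \<longleftrightarrow> P j"
proof -
  define n where "n = (LEAST n. P (int n))"
  have "i \<ge> 0" using neg ex not_le by blast
  then have "P (int n)" unfolding n_def using ex LeastI[of "\<lambda>n. P (int n)" "nat i"] by simp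
  have le: "int n \<le> j" if "P j" for j
  proof -
    have "j \<ge> 0" using neg that not_le by blast
    then have "n \<le> nat j" unfolding n_def using that by (intro Least_le[of "\<lambda>n. P (int n)"]) simp
    then show ?thesis using \<open>j \<ge> 0\<close> by linarith
  qed
  have "(LEAST i. P i) = int n" by (rule Least_equality) fact+
  then show ?thesis using mono le \<open>P (int n)\<close> by metis
qed

lemma mpoly_ring_minus:
  assumes "subfield K (ring_of_type_algebra :: 'l::field ring)"
    and f: "f \<in> carrier (mpoly_ring K :: ('x, 'l) mpoly ring)" "g \<in> carrier (mpoly_ring K)"
  shows "f \<ominus>\<^bsub>mpoly_ring K\<^esub> g = f - g"
proof -
  interpret P: cring "mpoly_ring K :: ('x, 'l) mpoly ring" by (rule mpoly_ring_cring[OF assms(1)])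
  have "\<ominus>\<^bsub>mpoly_ring K\<^esub> g = - g"
    using f subfield_type_algebra[OF assms(1)] by (intro P.minus_equality) (auto simp: mpoly_ring_simps(1))
  then show ?thesis by (simp add: a_minus_def)
qed

text \<open>Lets dimension arguments speak of sets of polynomials containing \<open>I\<close>
  instead of sets of cosets. For a subfield \<open>K\<close>, negatives come from the scalar
  -1.\<close>

definition subspace_over :: "'a::field set \<Rightarrow> ('x, 'a) mpoly set \<Rightarrow> bool" where
  "subspace_over K V \<longleftrightarrow> V \<subseteq> carrier (mpoly_ring K) \<and> 0 \<in> V \<and> (\<forall>f\<in>V. \<forall>g\<in>V. f + g \<in> V) \<and>
     (\<forall>k\<in>K. \<forall>f\<in>V. cst k * f \<in> V)"

section \<open>Cosets of polynomials and the quotient as an algebra over \<open>K\<close>\<close>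

locale proper_ideal =
  fixes K :: "'l::field set" and I :: "('x, 'l) mpoly set"
  assumes K: "subfield K (ring_of_type_algebra :: 'l ring)"
    and I: "ideal I (mpoly_ring K)" and proper: "I \<noteq> carrier (mpoly_ring K)"
begin

abbreviation "P \<equiv> mpoly_ring K :: ('x, 'l) mpoly ring"
abbreviation "C \<equiv> carrier (mpoly_ring K) :: ('x, 'l) mpoly set"
abbreviation "coset f \<equiv> I +>\<^bsub>mpoly_ring K\<^esub> f"

lemmas K_simps = subfield_type_algebra[OF K]

sublocale P: cring P by (rule mpoly_ring_cring[OF K])
sublocale I: ideal I P by (rule I)
sublocale Q: cring "quot_ring K I" by (rule I.quotient_is_cring[OF P.is_cring])

lemma C_closed [simp]:
  "0 \<in> C" "1 \<in> C" "f \<in> C \<Longrightarrow> g \<in> C \<Longrightarrow> f + g \<in> C" "f \<in> C \<Longrightarrow> g \<in> C \<Longrightarrow> f * g \<in> C"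
  "f \<in> C \<Longrightarrow> - f \<in> C" "f \<in> C \<Longrightarrow> g \<in> C \<Longrightarrow> f - g \<in> C" "k \<in> K \<Longrightarrow> cst k \<in> C"
  "f \<in> C \<Longrightarrow> f ^ n \<in> C"
proof -
  show m: "f \<in> C \<Longrightarrow> g \<in> C \<Longrightarrow> f * g \<in> C" for f g using P.m_closed by simp
  show "1 \<in> C" using P.one_closed by simp
  with m show "f \<in> C \<Longrightarrow> f ^ n \<in> C" by (induction n) auto
  show "f \<in> C \<Longrightarrow> g \<in> C \<Longrightarrow> f - g \<in> C"
    using P.minus_closed[of f g] mpoly_ring_minus[OF K, of f g] by simp
qed (use K_simps in \<open>auto simp: mpoly_ring_simps(1) lookup_add lookup_single when_def\<close>)

lemma ideal_iff: "ideal J P \<longleftrightarrow> J \<subseteq> C \<and> 0 \<in> J \<and> (\<forall>f\<in>J. \<forall>g\<in>J. f + g \<in> J) \<and> (\<forall>f\<in>J. \<forall>g\<in>C. f * g \<in> J)"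
  by (rule ideal_mpoly_ring_iff[OF K])

lemma ideal_closed:
  assumes "ideal J P"
  shows "0 \<in> J" "f \<in> J \<Longrightarrow> f \<in> C" "f \<in> J \<Longrightarrow> g \<in> J \<Longrightarrow> f + g \<in> J" "f \<in> J \<Longrightarrow> g \<in> C \<Longrightarrow> f * g \<in> J"
    "f \<in> J \<Longrightarrow> g \<in> C \<Longrightarrow> g * f \<in> J" "f \<in> J \<Longrightarrow> - f \<in> J" "f \<in> J \<Longrightarrow> g \<in> J \<Longrightarrow> f - g \<in> J"
proof -
  note J = assms[unfolded ideal_iff]
  show "0 \<in> J" "f \<in> J \<Longrightarrow> f \<in> C" "f \<in> J \<Longrightarrow> g \<in> J \<Longrightarrow> f + g \<in> J" "f \<in> J \<Longrightarrow> g \<in> C \<Longrightarrow> f * g \<in> J"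
    "f \<in> J \<Longrightarrow> g \<in> C \<Longrightarrow> g * f \<in> J" using J by (auto simp: mult.commute)
  have neg: "f \<in> J \<Longrightarrow> - f \<in> J" for f
  proof -
    assume "f \<in> J"
    then have "f * (- 1) \<in> J" using J C_closed(2,5) by blast
    then show ?thesis by simp
  qed
  show "f \<in> J \<Longrightarrow> - f \<in> J" by (rule neg)
  show "f \<in> J \<Longrightarrow> g \<in> J \<Longrightarrow> f - g \<in> J" using J neg[of g] by (metis add_uminus_conv_diff)
qed

lemmas I_closed = ideal_closed[OF I]

lemma one_notin_proper: "ideal J P \<Longrightarrow> J \<noteq> C \<Longrightarrow> 1 \<notin> J"
  using ideal.one_imp_carrier[of J P] by auto

lemma ideal_subspace: "ideal J P \<Longrightarrow> subspace_over K J"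
  unfolding subspace_over_def by (auto simp: ideal_closed)

lemma coset_eq_iff: "f \<in> C \<Longrightarrow> g \<in> C \<Longrightarrow> coset f = coset g \<longleftrightarrow> f - g \<in> I"
  using P.quotient_eq_iff_same_a_r_cos[OF I, of f g] mpoly_ring_minus[OF K, of f g] by simp

lemma quot_carrier: "carrier (quot_ring K I) = coset ` C"
  unfolding FactRing_def A_RCOSETS_def'[of P I] by auto

lemma coset_add: "f \<in> C \<Longrightarrow> g \<in> C \<Longrightarrow> coset f \<oplus>\<^bsub>quot_ring K I\<^esub> coset g = coset (f + g)"
  using ring_hom_add[OF I.rcos_ring_hom, of f g] by simp

lemma coset_mult: "f \<in> C \<Longrightarrow> g \<in> C \<Longrightarrow> coset f \<otimes>\<^bsub>quot_ring K I\<^esub> coset g = coset (f * g)"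
  using ring_hom_mult[OF I.rcos_ring_hom, of f g] by simp

lemma quot_zero: "\<zero>\<^bsub>quot_ring K I\<^esub> = coset 0"
  using ring_hom_zero[OF I.rcos_ring_hom P.ring_axioms Q.ring_axioms] by simp

lemma quot_one: "\<one>\<^bsub>quot_ring K I\<^esub> = coset 1"
  using ring_hom_one[OF I.rcos_ring_hom] by simp

text \<open>Properness of \<open>I\<close> separates 1 from 0 in the quotient, so the constants map
  onto a field there.\<close>

lemma scalars_subfield: "subfield (quot_scalars K I) (quot_ring K I)"
proof -
  interpret h: ring_hom_ring P "quot_ring K I" "(+>\<^bsub>P\<^esub>) I" by (rule I.rcos_ring_hom_ring)
  have "coset 1 \<noteq> coset 0"
    using coset_eq_iff[of 1 0] one_notin_proper[OF I proper] by simp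
  then show ?thesis unfolding quot_scalars_def quot_img_def
    using h.img_is_subfield(2)[OF subfield_constants[OF K]] quot_zero quot_one by simp
qed

lemma quot_img_subalgebra:
  assumes "subspace_over K V"
  shows "subalgebra (quot_scalars K I) (quot_img K I V) (quot_ring K I)"
proof -
  interpret h: ring_hom_ring P "quot_ring K I" "(+>\<^bsub>P\<^esub>) I" by (rule I.rcos_ring_hom_ring)
  note V = assms[unfolded subspace_over_def]
  have neg: "\<ominus>\<^bsub>P\<^esub> f \<in> V" if "f \<in> V" for f
  proof -
    have "f \<in> C" using V that by blast
    then have "\<ominus>\<^bsub>P\<^esub> f = - f" by (intro P.minus_equality) auto
    moreover have "cst (- 1) * f \<in> V" using V that K_simps by blast
    moreover have "cst (- 1) * f = - f" by (simp add: single_uminus)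
    ultimately show ?thesis by simp
  qed
  have "subalgebra (cst ` K) V P"
  proof
    show "inv\<^bsub>add_monoid P\<^esub> f \<in> V" if "f \<in> V" for f using neg[OF that] by (simp add: a_inv_def)
  qed (use V in auto)
  then show ?thesis unfolding quot_scalars_def quot_img_def
    by (intro h.img_is_subalgebra) auto
qed

lemma quot_img_mem_iff:
  assumes "f \<in> C" "V \<subseteq> C"
  shows "coset f \<in> quot_img K I V \<longleftrightarrow> (\<exists>g\<in>V. f - g \<in> I)"
  using assms unfolding quot_img_def by (auto simp: coset_eq_iff subset_iff image_iff)

text \<open>A finite set \<open>S\<close> spans modulo \<open>I\<close>, with spanning expressed by
  testing against all subspaces. No quotient occurs in this form, so it passes easily to a larger
  ideal and to a larger field, and it yields a degree bound.\<close>

lemma zero_dimensional_iff: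
  "zero_dimensional K I \<longleftrightarrow>
    (\<exists>S\<subseteq>C. finite S \<and> (\<forall>V. subspace_over K V \<longrightarrow> I \<subseteq> V \<longrightarrow> S \<subseteq> V \<longrightarrow> V = C))" (is "_ \<longleftrightarrow> ?r")
proof
  assume "zero_dimensional K I"
  then have "Q.finite_dimension (quot_scalars K I) (carrier (quot_ring K I))"
    by (simp add: zero_dimensional_def)
  then obtain Us where Us: "set Us \<subseteq> carrier (quot_ring K I)"
    "Q.Span (quot_scalars K I) Us = carrier (quot_ring K I)"
    using Q.exists_base[OF scalars_subfield Q.finite_dimensionE[OF scalars_subfield]] by metis
  then obtain S where S: "S \<subseteq> C" "finite S" "set Us = coset ` S"
    unfolding quot_carrier using finite_subset_image[of "set Us" coset C] by auto
  have "V = C" if V: "subspace_over K V" "I \<subseteq> V" "S \<subseteq> V" for V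
  proof -
    have VC: "V \<subseteq> C" using V(1) by (simp add: subspace_over_def)
    have "set Us \<subseteq> quot_img K I V" using S(3) V(3) by (auto simp: quot_img_def)
    then have *: "coset ` C \<subseteq> quot_img K I V"
      using Q.subalgebra_Span_incl[OF scalars_subfield quot_img_subalgebra[OF V(1)]] Us(2)
      unfolding quot_carrier by metis
    have "f \<in> V" if f: "f \<in> C" for f
    proof -
      obtain g where g: "g \<in> V" "f - g \<in> I" using * quot_img_mem_iff[OF f VC] f by blast
      then have "g + (f - g) \<in> V" using V(1,2) unfolding subspace_over_def by blast
      then show ?thesis by simp
    qed
    with VC show "V = C" by blast
  qed
  with S show ?r by blast
next
  assume ?r
  then obtain S where S: "S \<subseteq> C" "finite S"
    "\<And>V. subspace_over K V \<Longrightarrow> I \<subseteq> V \<Longrightarrow> S \<subseteq> V \<Longrightarrow> V = C" by blast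
  obtain xs where xs: "set xs = S" using S(2) finite_list by blast
  define Us where "Us = map coset xs"
  have Us: "set Us \<subseteq> carrier (quot_ring K I)" using S(1) xs by (auto simp: Us_def quot_carrier)
  define E where "E = Q.Span (quot_scalars K I) Us"
  interpret E: subalgebra "quot_scalars K I" E "quot_ring K I"
    unfolding E_def by (rule Q.Span_is_subalgebra[OF scalars_subfield Us])
  \<comment> \<open>The preimage of the span of the classes of \<open>S\<close>; it contains
    \<open>I\<close> and \<open>S\<close>, so by hypothesis it is everything.\<close>
  define V where "V = {f \<in> C. coset f \<in> E}"
  have add: "f + g \<in> V" if "f \<in> V" "g \<in> V" for f g
    using that E.m_closed[of "coset f" "coset g"] coset_add[of f g] by (auto simp: V_def)
  have smult: "cst k * f \<in> V" if "k \<in> K" "f \<in> V" for k f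
  proof -
    have "coset (cst k) \<in> quot_scalars K I" using that by (auto simp: quot_scalars_def quot_img_def)
    then show ?thesis
      using that E.smult_closed[of "coset (cst k)" "coset f"] coset_mult[of "cst k" f] by (auto simp: V_def)
  qed
  have zero: "coset 0 \<in> E" using E.one_closed quot_zero by simp
  have "V = C"
  proof (rule S(3))
    show "subspace_over K V" unfolding subspace_over_def
      using zero add smult by (auto simp: V_def)
    show "I \<subseteq> V"
    proof
      fix f assume f: "f \<in> I"
      then have "coset f = coset 0" by (subst coset_eq_iff) (auto simp: I_closed)
      then show "f \<in> V" using f zero by (simp add: V_def I_closed)
    qed
    show "S \<subseteq> V"
      using S(1) xs Q.Span_base_incl[OF scalars_subfield Us] by (auto simp: V_def E_def Us_def)
  qed
  then have "coset ` C \<subseteq> E" by (auto simp: V_def)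
  moreover have "E \<subseteq> coset ` C"
    unfolding E_def quot_carrier[symmetric] by (rule Q.Span_in_carrier[OF _ Us])
      (use subfieldE(3)[OF scalars_subfield] in simp)
  ultimately have "E = carrier (quot_ring K I)" by (simp add: quot_carrier)
  then show "zero_dimensional K I"
    using Q.Span_finite_dimension[OF scalars_subfield Us] I proper
    by (simp add: zero_dimensional_def E_def)
qed

end

lemma (in proper_ideal) zero_dimensional_mono:
  assumes "zero_dimensional K I" "ideal M P" "I \<subseteq> M" "M \<noteq> C"
  shows "zero_dimensional K M"
proof -
  interpret M: proper_ideal K M using K assms by (intro proper_ideal.intro)
  from assms(1) obtain S where S: "S \<subseteq> C" "finite S"
    "\<And>V. subspace_over K V \<Longrightarrow> I \<subseteq> V \<Longrightarrow> S \<subseteq> V \<Longrightarrow> V = C"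
    unfolding zero_dimensional_iff by blast
  then show ?thesis unfolding M.zero_dimensional_iff using assms(3) by (meson order_trans)
qed

locale zero_dim_ideal = proper_ideal K I
  for K :: "'l::field set" and I :: "('x, 'l) mpoly set" +
  assumes zero_dim: "zero_dimensional K I"
begin

text \<open>Measured upwards from \<open>I\<close>: this is the dimension of the image of
  \<open>V\<close> in R, so it increases with \<open>V\<close> and vanishes at
  \<open>I\<close>.\<close>

abbreviation "codim V \<equiv> quot_dim K I (quot_img K I V)"

lemma quot_finite: "Q.finite_dimension (quot_scalars K I) (carrier (quot_ring K I))"
  using zero_dim by (simp add: zero_dimensional_def)

lemma subspace_finite:
  assumes "subspace_over K V"
  shows "Q.finite_dimension (quot_scalars K I) (quot_img K I V)"
  using assms unfolding subspace_over_def
  by (intro Q.subalbegra_incl_imp_finite_dimension[OF scalars_subfield quot_finite quot_img_subalgebra[OF assms]])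
    (auto simp: quot_img_def quot_carrier)

lemma dim_over: "quot_dim K I E = (Q.dim over (quot_scalars K I)) E"
  by (simp add: quot_dim_def over_def)

lemma quot_dim_less:
  assumes "subspace_over K V" "subspace_over K W" "quot_img K I V \<subset> quot_img K I W"
  shows "codim V < codim W"
  unfolding dim_over
  by (rule Q.dim_mono_strict[OF scalars_subfield subspace_finite quot_img_subalgebra]) fact+

text \<open>As \<open>I \<subseteq> V\<close>, the set \<open>V\<close> is recovered from its image,
  so an element of \<open>W\<close> outside \<open>V\<close> has its class outside that image. This
  strict growth is what replaces the ascending and descending chain conditions.\<close>

lemma codim_less:
  assumes "subspace_over K V" "subspace_over K W" "I \<subseteq> V" "V \<subset> W"
  shows "codim V < codim W"
proof (rule quot_dim_less)
  from assms(4) obtain f where f: "f \<in> W" "f \<notin> V" by blast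
  have sub: "V \<subseteq> C" "f \<in> C" using assms(1,2) f(1) by (auto simp: subspace_over_def)
  have "coset f \<notin> quot_img K I V"
  proof
    assume "coset f \<in> quot_img K I V"
    then obtain g where g: "g \<in> V" "f - g \<in> I" using quot_img_mem_iff sub by blast
    then have "g + (f - g) \<in> V" using assms(1,3) unfolding subspace_over_def by blast
    then show False using f by simp
  qed
  then show "quot_img K I V \<subset> quot_img K I W" using assms(4) f(1) by (auto simp: quot_img_def)
qed (use assms in auto)

lemma codim_le:
  assumes "subspace_over K V" "subspace_over K W" "I \<subseteq> V" "V \<subseteq> W"
  shows "codim V \<le> codim W"
  using codim_less[OF assms(1-3)] assms(4) by (cases "V = W") (auto simp: less_imp_le)

section \<open>Maximal and minimal ideals above \<open>I\<close>\<close>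

definition maximal :: "('x, 'l) mpoly set \<Rightarrow> bool" where
  "maximal M \<longleftrightarrow> ideal M P \<and> I \<subseteq> M \<and> M \<noteq> C \<and> (\<forall>N. ideal N P \<longrightarrow> M \<subseteq> N \<longrightarrow> N = M \<or> N = C)"

lemma C_ideal: "ideal C P"
  by (rule P.oneideal)

lemma maximal_ideal: "maximal M \<Longrightarrow> ideal M P"
  by (simp add: maximal_def)

lemma maximal_one: "maximal M \<Longrightarrow> 1 \<notin> M"
  using one_notin_proper by (auto simp: maximal_def)

definition adjoin :: "('x, 'l) mpoly set \<Rightarrow> ('x, 'l) mpoly \<Rightarrow> ('x, 'l) mpoly set" where
  "adjoin J f = {a + f * g | a g. a \<in> J \<and> g \<in> C}"

lemma adjoin:
  assumes J: "ideal J P" and f: "f \<in> C"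
  shows "ideal (adjoin J f) P" "J \<subseteq> adjoin J f" "f \<in> adjoin J f"
    "\<And>N. ideal N P \<Longrightarrow> J \<subseteq> N \<Longrightarrow> f \<in> N \<Longrightarrow> adjoin J f \<subseteq> N"
proof -
  note Jc = ideal_closed[OF J]
  have *: "a \<in> J \<Longrightarrow> g \<in> C \<Longrightarrow> a + f * g \<in> adjoin J f" for a g by (auto simp: adjoin_def)
  show "J \<subseteq> adjoin J f" using *[of _ 0] by auto
  show "f \<in> adjoin J f" using *[of 0 1] Jc by simp
  show "adjoin J f \<subseteq> N" if "ideal N P" "J \<subseteq> N" "f \<in> N" for N
    using that(2,3) ideal_closed(3,4)[OF that(1)] unfolding adjoin_def by blast
  have add: "x + y \<in> adjoin J f" if xy: "x \<in> adjoin J f" "y \<in> adjoin J f" for x y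
  proof -
    from xy obtain a g b h where "a \<in> J" "g \<in> C" "x = a + f * g" "b \<in> J" "h \<in> C" "y = b + f * h"
      by (auto simp: adjoin_def)
    then show ?thesis using *[of "a + b" "g + h"] Jc by (simp add: algebra_simps)
  qed
  have mult: "x * y \<in> adjoin J f" if xy: "x \<in> adjoin J f" "y \<in> C" for x y
  proof -
    from xy obtain a g where "a \<in> J" "g \<in> C" "x = a + f * g" by (auto simp: adjoin_def)
    then show ?thesis using *[of "a * y" "g * y"] Jc xy(2) by (simp add: algebra_simps)
  qed
  have "adjoin J f \<subseteq> C" using Jc f by (auto simp: adjoin_def)
  moreover have "0 \<in> adjoin J f" using *[of 0 0] Jc by simp
  ultimately show "ideal (adjoin J f) P" unfolding ideal_iff using add mult by blast
qed

text \<open>The values of \<open>codim\<close> are bounded by the dimension of R, so a proper ideal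
  of greatest \<open>codim\<close> takes the place of Zorn's lemma.\<close>

lemma exists_maximal:
  assumes "ideal J P" "I \<subseteq> J" "J \<noteq> C"
  obtains M where "maximal M" "J \<subseteq> M"
proof -
  let ?A = "\<lambda>N. ideal N P \<and> J \<subseteq> N \<and> N \<noteq> C"
  have "\<forall>N. ?A N \<longrightarrow> codim N \<le> codim C"
  proof (intro allI impI codim_le)
    show "subspace_over K N" "I \<subseteq> N" "N \<subseteq> C" if "?A N" for N
      using that assms(2) ideal_subspace[of N] by (auto simp: ideal_iff)
  qed (rule ideal_subspace[OF C_ideal])
  then obtain M where M: "?A M" "\<And>N. ?A N \<Longrightarrow> codim N \<le> codim M"
    using ex_has_greatest_nat[of ?A J codim "Suc (codim C)"] assms
    unfolding less_Suc_eq_le by blast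
  have "N = M" if N: "ideal N P" "M \<subseteq> N" "N \<noteq> C" for N
  proof (rule ccontr)
    assume "N \<noteq> M"
    then have "codim M < codim N"
      using M(1) N assms by (intro codim_less) (auto simp: ideal_subspace)
    then show False using M(2)[of N] M(1) N by auto
  qed
  then show thesis using that[of M] M(1) assms by (auto simp: maximal_def)
qed

lemma exists_minimal:
  assumes "ideal J P" "I \<subset> J"
  obtains N where "ideal N P" "I \<subset> N" "N \<subseteq> J"
    "\<And>N'. ideal N' P \<Longrightarrow> I \<subset> N' \<Longrightarrow> N' \<subseteq> N \<Longrightarrow> N' = N"
proof -
  let ?A = "\<lambda>N. ideal N P \<and> I \<subset> N \<and> N \<subseteq> J"
  obtain N where N: "?A N" "\<And>N'. ?A N' \<Longrightarrow> codim N \<le> codim N'"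
    using ex_has_least_nat[of ?A J codim] assms by blast
  have "N' = N" if N': "ideal N' P" "I \<subset> N'" "N' \<subseteq> N" for N'
  proof (rule ccontr)
    assume "N' \<noteq> N"
    then have "codim N' < codim N"
      using N(1) N' by (intro codim_less) (auto simp: ideal_subspace)
    then show False using N(2)[of N'] N(1) N' by auto
  qed
  then show thesis using that N(1) by blast
qed

lemma maximal_unit:
  assumes "maximal M" "f \<in> C" "f \<notin> M"
  obtains m g where "m \<in> M" "g \<in> C" "1 = m + f * g"
proof -
  have "adjoin M f = C"
    using assms adjoin[OF maximal_ideal[OF assms(1)] assms(2)] unfolding maximal_def by blast
  then have "1 \<in> adjoin M f" by simp
  then show thesis using that unfolding adjoin_def by blast
qed

lemma maximal_prime:
  assumes "maximal M" "f \<in> C" "g \<in> C" "f * g \<in> M" "f \<notin> M"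
  shows "g \<in> M"
proof -
  note Mc = ideal_closed[OF maximal_ideal[OF assms(1)]]
  from maximal_unit[OF assms(1,2,5)] obtain m h where h: "m \<in> M" "h \<in> C" "1 = m + f * h" .
  have "(m + f * h) * g \<in> M"
    using Mc(3)[OF Mc(4)[OF h(1) assms(3)] Mc(4)[OF assms(4) h(2)]] by (simp add: algebra_simps)
  moreover have "(m + f * h) * g = g" using h(3) by (metis mult_1)
  ultimately show ?thesis by simp
qed

lemma maximal_power:
  assumes "maximal M" "f \<in> C" "f ^ k \<in> M"
  shows "f \<in> M"
  using assms(3)
proof (induction k)
  case 0 then show ?case using maximal_one[OF assms(1)] by simp
next
  case (Suc k) then show ?case using maximal_prime[OF assms(1,2), of "f ^ k"] assms(2) by auto
qed

text \<open>An \<open>f\<close> in \<open>N\<close> outside \<open>M\<close> multiplies the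
  intersection of the remaining ideals into the full intersection, hence into \<open>M\<close>, and
  primality removes \<open>f\<close> again. The factor \<open>C\<close> gives the empty intersection
  its proper value.\<close>

lemma prime_avoid:
  assumes "maximal M" "finite Y" "\<And>N. N \<in> Y \<Longrightarrow> ideal N P" "C \<inter> \<Inter>Y \<subseteq> M"
  shows "\<exists>N\<in>Y. N \<subseteq> M"
  using assms(2-4)
proof (induction Y)
  case empty
  then show ?case using maximal_one[OF assms(1)] by auto
next
  case (insert N Y)
  show ?case
  proof (cases "N \<subseteq> M")
    case False
    then obtain f where f: "f \<in> N" "f \<notin> M" by blast
    have N: "ideal N P" using insert.prems by simp
    have "g \<in> M" if g: "g \<in> C \<inter> \<Inter>Y" for g
    proof -
      have fC: "f \<in> C" and gC: "g \<in> C" using ideal_closed(2)[OF N f(1)] g by auto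
      have "f * g \<in> N'" if "N' \<in> Y" for N'
        using ideal_closed(5)[of N' g f] insert.prems(1) g that fC by auto
      then have "f * g \<in> C \<inter> \<Inter>(insert N Y)"
        using ideal_closed(4)[OF N f(1) gC] fC gC by auto
      then have "f * g \<in> M" using insert.prems(2) by blast
      then show ?thesis using maximal_prime[OF assms(1) fC gC _ f(2)] by blast
    qed
    then have "C \<inter> \<Inter>Y \<subseteq> M" by blast
    then show ?thesis using insert by auto
  qed auto
qed

lemma maximal_incl: "maximal M \<Longrightarrow> maximal N \<Longrightarrow> M \<subseteq> N \<Longrightarrow> M = N"
  by (auto simp: maximal_def)

lemma Inter_ideal: "(\<And>N. N \<in> Y \<Longrightarrow> ideal N P) \<Longrightarrow> ideal (C \<inter> \<Inter>Y) P"
  unfolding ideal_iff by (auto intro: C_closed)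

text \<open>Every further maximal ideal shrinks the intersection strictly, since otherwise it would
  contain one of the earlier ones. Each step costs at least one dimension, so the dimension of R
  bounds their number.\<close>

lemma finite_maximal: "finite {M. maximal M}"
proof -
  have "card Y + codim (C \<inter> \<Inter>Y) \<le> codim C" if "finite Y" "Y \<subseteq> {M. maximal M}" for Y
    using that
  proof (induction Y)
    case (insert M Y)
    have M: "maximal M" and Y: "\<And>N. N \<in> Y \<Longrightarrow> maximal N" using insert.prems by auto
    have "\<not> C \<inter> \<Inter>Y \<subseteq> M"
    proof
      assume "C \<inter> \<Inter>Y \<subseteq> M"
      then obtain N where "N \<in> Y" "N \<subseteq> M"
        using prime_avoid[OF M insert.hyps(1)] Y maximal_ideal by blast
      then show False using maximal_incl[OF Y M] insert.hyps(2) by blast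
    qed
    then have "C \<inter> \<Inter>(insert M Y) \<subset> C \<inter> \<Inter>Y" by auto
    moreover have "I \<subseteq> C \<inter> \<Inter>(insert M Y)" using M Y I_closed(2) by (auto simp: maximal_def)
    ultimately have "codim (C \<inter> \<Inter>(insert M Y)) < codim (C \<inter> \<Inter>Y)"
      using M Y by (intro codim_less ideal_subspace Inter_ideal) (auto simp: maximal_ideal)
    then show ?case using insert by simp
  qed simp
  then have "card Y \<le> codim C" if "finite Y" "Y \<subseteq> {M. maximal M}" for Y
    using that by (meson add_leD1)
  then show ?thesis using finite_if_finite_subsets_card_bdd[of "{M. maximal M}" "codim C"] by blast
qed

end

section \<open>Primary decompositions and minimal divisors\<close>

context zero_dim_ideal begin

section \<open>Radicals and primary components in dimension zero\<close>

lemma radical_eq: "ideal_radical P Q = {f \<in> C. \<exists>k. f ^ k \<in> Q}"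
proof -
  have "f [^]\<^bsub>P\<^esub> (k::nat) = f ^ k" for f k
    by (induction k) (simp_all add: mult.commute)
  then show ?thesis by (simp add: ideal_radical_def)
qed

lemma primary_iff:
  "primary_ideal Q P \<longleftrightarrow> ideal Q P \<and> Q \<noteq> C \<and>
    (\<forall>a\<in>C. \<forall>b\<in>C. a * b \<in> Q \<longrightarrow> a \<in> Q \<or> (\<exists>k. b ^ k \<in> Q))"
  by (auto simp: primary_ideal_def radical_eq)

text \<open>The ideals I + (f^k) descend and must become stationary, so f^k lies in I + (f^(k+1))
  for some k. The factor \<open>1 - f * g\<close> lies outside every maximal ideal containing
  \<open>f\<close> and later serves as a denominator.\<close>

lemma power_stable:
  assumes f: "f \<in> C"
  obtains k g where "g \<in> C" "f ^ k * (1 - f * g) \<in> I"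
proof -
  obtain k where k: "\<And>j. codim (adjoin I (f ^ k)) \<le> codim (adjoin I (f ^ j))"
    using ex_has_least_nat[of "\<lambda>_. True" 0 "\<lambda>k. codim (adjoin I (f ^ k))"] by blast
  note a = adjoin[OF I C_closed(8)[OF f]]
  have "f ^ Suc k \<in> adjoin I (f ^ k)"
    using ideal_closed(4)[OF a(1) a(3) f, of k] by (simp add: mult.commute)
  then have "adjoin I (f ^ Suc k) \<subseteq> adjoin I (f ^ k)"
    by (intro a(4)[OF a(1) a(2)])
  moreover have "\<not> adjoin I (f ^ Suc k) \<subset> adjoin I (f ^ k)"
    using k[of "Suc k"] codim_less[OF ideal_subspace[OF a(1)] ideal_subspace[OF a(1)] a(2)]
    by (metis not_less)
  ultimately have "f ^ k \<in> adjoin I (f ^ Suc k)" using a(3) by blast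
  then obtain b g where b: "b \<in> I" and g: "g \<in> C" and eq: "f ^ k = b + f ^ Suc k * g"
    unfolding adjoin_def by blast
  have "f ^ k * (1 - f * g) = f ^ k - f ^ Suc k * g" by (simp add: algebra_simps)
  then have "f ^ k * (1 - f * g) \<in> I" using b eq by (metis add_diff_cancel_right')
  then show thesis using that[OF g] by blast
qed

lemma maximal_unit_minus:
  assumes "maximal M" "f \<in> M" "g \<in> C"
  shows "1 - f * g \<notin> M"
proof
  note Mc = ideal_closed[OF maximal_ideal[OF assms(1)]]
  assume "1 - f * g \<in> M"
  then have "1 - f * g + f * g \<in> M" using Mc(3,4) assms by blast
  then show False using maximal_one[OF assms(1)] by simp
qed

text \<open>Take a maximal \<open>M\<close> above \<open>Q\<close> and \<open>f\<close> in
  \<open>M\<close>. By \<open>power_stable\<close> some f^k (1 - f g) lies in \<open>Q\<close>,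
  while no power of 1 - f g does because it avoids \<open>M\<close>; as \<open>Q\<close> is primary,
  f^k is in \<open>Q\<close>.\<close>

lemma radical_maximal:
  assumes "primary_ideal Q P" "I \<subseteq> Q"
  shows "maximal (ideal_radical P Q)"
proof -
  note Q = assms(1)[unfolded primary_iff]
  obtain M where M: "maximal M" "Q \<subseteq> M" using exists_maximal[of Q] Q assms(2) by blast
  have "ideal_radical P Q = M"
  proof
    show "ideal_radical P Q \<subseteq> M"
      unfolding radical_eq using M maximal_power by blast
    show "M \<subseteq> ideal_radical P Q"
    proof
      fix f assume f: "f \<in> M"
      then have fC: "f \<in> C" using ideal_closed(2)[OF maximal_ideal[OF M(1)]] by blast
      obtain k g where kg: "g \<in> C" "f ^ k * (1 - f * g) \<in> I" by (rule power_stable[OF fC])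
      have c: "f ^ k \<in> C" "1 - f * g \<in> C" using fC kg(1) by auto
      have "\<not> (\<exists>m. (1 - f * g) ^ m \<in> Q)"
        using maximal_unit_minus[OF M(1) f kg(1)] M maximal_power[OF M(1) c(2)] by blast
      then have "f ^ k \<in> Q" using Q c kg(2) assms(2) by blast
      then show "f \<in> ideal_radical P Q" using fC unfolding radical_eq by blast
    qed
  qed
  then show ?thesis using M by simp
qed

text \<open>The contraction of \<open>I\<close> from the localization at \<open>M\<close>.\<close>

definition component :: "('x, 'l) mpoly set \<Rightarrow> ('x, 'l) mpoly set" where
  "component M = {f \<in> C. \<exists>g\<in>C. g \<notin> M \<and> g * f \<in> I}"

lemma componentI: "f \<in> C \<Longrightarrow> g \<in> C \<Longrightarrow> g \<notin> M \<Longrightarrow> g * f \<in> I \<Longrightarrow> f \<in> component M"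
  unfolding component_def by blast

text \<open>The substantial claim is primariness. If \<open>g\<close> is in \<open>M\<close>, the
  element 1 - g h from \<open>power_stable\<close> is a denominator that puts a power of
  \<open>g\<close> into the component. If \<open>g\<close> is not in \<open>M\<close>, it can be
  absorbed into the denominator that belongs to \<open>f * g\<close>.\<close>

lemma component:
  assumes M: "maximal M"
  shows "primary_ideal (component M) P" "I \<subseteq> component M" "component M \<subseteq> M"
    "ideal_radical P (component M) = M"
proof -
  have prime: "g * h \<notin> M" if "g \<in> C" "h \<in> C" "g \<notin> M" "h \<notin> M" for g h
    using maximal_prime[OF M that(1,2)] that by blast
  show sub: "component M \<subseteq> M"
  proof
    fix f assume "f \<in> component M"
    then obtain g where g: "f \<in> C" "g \<in> C" "g \<notin> M" "g * f \<in> I" unfolding component_def by blast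
    moreover have "I \<subseteq> M" using M by (simp add: maximal_def)
    ultimately show "f \<in> M" using maximal_prime[OF M g(2,1)] by blast
  qed
  show IQ: "I \<subseteq> component M"
  proof
    fix f assume f: "f \<in> I"
    then have "1 * f \<in> I" by simp
    then show "f \<in> component M"
      using f I_closed(2)[OF f] C_closed(2) maximal_one[OF M] unfolding component_def by blast
  qed
  have add: "a + b \<in> component M" if ab: "a \<in> component M" "b \<in> component M" for a b
  proof -
    from ab obtain g h where gh: "g \<in> C" "g \<notin> M" "g * a \<in> I" "h \<in> C" "h \<notin> M" "h * b \<in> I" "a \<in> C" "b \<in> C"
      unfolding component_def by blast
    have "(g * a) * h + (h * b) * g \<in> I"
      by (rule I_closed(3)[OF I_closed(4)[OF gh(3,4)] I_closed(4)[OF gh(6,1)]])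
    then have "(g * h) * (a + b) \<in> I" by (simp add: algebra_simps)
    then show ?thesis using gh prime by (intro componentI[of _ "g * h"]) simp_all
  qed
  have mult: "a * b \<in> component M" if ab: "a \<in> component M" "b \<in> C" for a b
  proof -
    from ab obtain g where g: "g \<in> C" "g \<notin> M" "g * a \<in> I" "a \<in> C" unfolding component_def by blast
    have "g * (a * b) \<in> I" using I_closed(4)[OF g(3) ab(2)] by (simp add: mult.assoc)
    then show ?thesis using g ab(2) by (intro componentI[of _ g]) simp_all
  qed
  have Qi: "ideal (component M) P" unfolding ideal_iff
    using add mult IQ I_closed(1) by (auto simp: component_def)
  have rad: "f \<in> component M \<or> (\<exists>k. g ^ k \<in> component M)" if fg: "f \<in> C" "g \<in> C" "f * g \<in> component M" for f g
  proof (cases "g \<in> M")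
    case True
    obtain k h where kh: "h \<in> C" "g ^ k * (1 - g * h) \<in> I" by (rule power_stable[OF fg(2)])
    have "1 - g * h \<in> C" "1 - g * h \<notin> M" "(1 - g * h) * g ^ k \<in> I"
      using maximal_unit_minus[OF M True kh(1)] kh fg(2) by (auto simp: mult.commute)
    then have "g ^ k \<in> component M" using fg(2) by (intro componentI[of _ "1 - g * h"]) simp_all
    then show ?thesis by blast
  next
    case False
    from fg obtain h where h: "h \<in> C" "h \<notin> M" "h * (f * g) \<in> I" unfolding component_def by blast
    then have "(h * g) * f \<in> I" by (simp add: mult_ac)
    then have "f \<in> component M"
      using h fg False prime by (intro componentI[of _ "h * g"]) (simp_all only: C_closed)
    then show ?thesis ..
  qed
  have "component M \<noteq> C" using sub maximal_one[OF M] by auto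
  with Qi rad show prim: "primary_ideal (component M) P" unfolding primary_iff by blast
  have "ideal_radical P (component M) \<subseteq> M"
    using sub maximal_power[OF M] unfolding radical_eq by blast
  then show "ideal_radical P (component M) = M"
    using maximal_incl[OF radical_maximal[OF prim IQ] M] by blast
qed

text \<open>The components at the finitely many maximal ideals above \<open>I\<close> are used. If
  one of them contained the intersection of the others, its maximal ideal would contain another
  component and hence that component's radical, which is a different maximal ideal.\<close>

lemma exists_primary_decomposition: "\<exists>s Q. primary_decomposition P I s Q"
proof -
  obtain h where h: "bij_betw h {1..card {M. maximal M}} {M. maximal M}"
    using ex_bij_betw_nat_finite_1[OF finite_maximal] by blast
  define s where "s = card {M. maximal M}"
  define Q where "Q i = component (h i)" for i
  have hM: "maximal (h i)" if "i \<in> {1..s}" for i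
    using bij_betwE[OF h] that unfolding s_def by simp
  have hinj: "i = j" if "i \<in> {1..s}" "j \<in> {1..s}" "h i = h j" for i j
    using inj_onD[OF bij_betw_imp_inj_on[OF h] that(3)] that(1,2) unfolding s_def by simp
  have hsurj: "\<exists>i\<in>{1..s}. h i = M" if "maximal M" for M
    using bij_betw_imp_surj_on[OF h] that unfolding s_def by (metis (no_types) imageE mem_Collect_eq)
  have prim: "primary_ideal (Q i) P" and IQ: "I \<subseteq> Q i" and QM: "Q i \<subseteq> h i" and rad: "ideal_radical P (Q i) = h i"
    if "i \<in> {1..s}" for i
    using component[OF hM[OF that]] unfolding Q_def by blast+
  have eq: "I = C \<inter> (\<Inter>i\<in>{1..s}. Q i)"
  proof
    show "I \<subseteq> C \<inter> (\<Inter>i\<in>{1..s}. Q i)" using IQ I_closed(2) by blast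
    show "C \<inter> (\<Inter>i\<in>{1..s}. Q i) \<subseteq> I"
    proof
      fix f assume "f \<in> C \<inter> (\<Inter>i\<in>{1..s}. Q i)"
      then have f: "f \<in> C" "\<And>M. maximal M \<Longrightarrow> f \<in> component M" using hsurj unfolding Q_def by blast+
      \<comment> \<open>The colon ideal I : f. Membership of \<open>f\<close> in
        \<open>component M\<close> provides an element of \<open>N\<close> outside \<open>M\<close>,
        so \<open>N\<close> lies in no maximal ideal and contains 1.\<close>
      define N where "N = {g \<in> C. g * f \<in> I}"
      have "a * b \<in> N" if "a \<in> N" "b \<in> C" for a b
        using that I_closed(4)[of "a * f" b] by (simp add: N_def mult_ac)
      then have "ideal N P" unfolding ideal_iff
        using I_closed(1,3) by (auto simp: N_def distrib_right)
      moreover have "I \<subseteq> N" using f(1) I_closed(2,4) by (auto simp: N_def)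
      ultimately have N: "ideal N P" "I \<subseteq> N" .
      have "N = C"
      proof (rule ccontr)
        assume "N \<noteq> C"
        then obtain M where M: "maximal M" "N \<subseteq> M" using exists_maximal[OF N] by blast
        then show False using f(2)[OF M(1)] unfolding component_def N_def by blast
      qed
      then have "1 \<in> N" by simp
      then show "f \<in> I" by (simp add: N_def)
    qed
  qed
  have irred: "\<not> C \<inter> (\<Inter>j\<in>{1..s} - {i}. Q j) \<subseteq> Q i" if i: "i \<in> {1..s}" for i
  proof
    assume "C \<inter> (\<Inter>j\<in>{1..s} - {i}. Q j) \<subseteq> Q i"
    then have "C \<inter> \<Inter>(Q ` ({1..s} - {i})) \<subseteq> h i" using QM[OF i] by blast
    moreover have "\<And>N. N \<in> Q ` ({1..s} - {i}) \<Longrightarrow> ideal N P" using prim unfolding primary_iff by blast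
    ultimately have "\<exists>N\<in>Q ` ({1..s} - {i}). N \<subseteq> h i" by (intro prime_avoid hM[OF i]) auto
    then obtain j where j: "j \<in> {1..s}" "j \<noteq> i" "Q j \<subseteq> h i" by blast
    have "h j \<subseteq> h i"
      unfolding rad[OF j(1), symmetric] radical_eq using j(3) maximal_power[OF hM[OF i]] by blast
    then show False using maximal_incl[OF hM[OF j(1)] hM[OF i]] hinj[OF j(1) i] j(2) by blast
  qed
  have "inj_on (\<lambda>i. ideal_radical P (Q i)) {1..s}"
    using rad hinj by (auto simp: inj_on_def)
  then have "primary_decomposition P I s Q"
    unfolding primary_decomposition_def using prim eq irred by blast
  then show ?thesis by blast
qed

section \<open>Minimal divisors and minimal ideals of the quotient\<close>

lemma quot_dim_maximal_pos:
  assumes "maximal M"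
  shows "quot_dim K M (carrier (quot_ring K M)) > 0"
proof -
  have M: "ideal M P" "M \<noteq> C" "I \<subseteq> M" using assms by (auto simp: maximal_def)
  interpret M: zero_dim_ideal K M
    by (intro zero_dim_ideal.intro proper_ideal.intro zero_dim_ideal_axioms.intro K M
        zero_dimensional_mono[OF zero_dim])
  have "M.codim M < M.codim C"
    using M ideal_closed(2)[OF M(1)]
    by (intro M.codim_less ideal_subspace M C_ideal) auto
  then show ?thesis by (simp add: M.quot_carrier quot_img_def)
qed

lemma codim_self: "codim I = 0"
proof -
  have "quot_img K I I = {\<zero>\<^bsub>quot_ring K I\<^esub>}"
  proof -
    have "coset f = coset 0" if "f \<in> I" for f
      using that I_closed(2)[OF that] by (subst coset_eq_iff) auto
    then show ?thesis unfolding quot_img_def quot_zero using I_closed(1) by blast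
  qed
  then show ?thesis
    unfolding dim_over using Q.dimI[OF scalars_subfield Q.zero_dim] by simp
qed

text \<open>The divisor cannot equal \<open>I\<close>, because J/I has the dimension of a residue
  field, which is positive.\<close>

lemma minimal_primary_divisor_ideal:
  assumes dec: "primary_decomposition P I s Q" and i: "i \<in> {1..s}" and J: "minimal_primary_divisor K I s Q i J"
  shows "ideal J P" "I \<subset> J"
proof -
  obtain Q' where Q': "ideal Q' P" "Q i \<subset> Q'" "J = (\<Inter>j\<in>{1..s}. (Q(i := Q')) j)"
    using J unfolding minimal_primary_divisor_def primary_divisor_def by blast
  have prim: "\<And>j. j \<in> {1..s} \<Longrightarrow> primary_ideal (Q j) P" and eq: "I = C \<inter> (\<Inter>i\<in>{1..s}. Q i)"
    using dec unfolding primary_decomposition_def by blast+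
  have "J \<subseteq> Q'" using i Q'(3) by auto
  then have "J \<subseteq> C" using ideal_closed(2)[OF Q'(1)] by blast
  then have "J = C \<inter> \<Inter>((Q(i := Q')) ` {1..s})" using Q'(3) by blast
  moreover have "ideal \<dots> P"
    by (rule Inter_ideal) (use prim Q'(1) in \<open>auto simp: primary_iff\<close>)
  ultimately show "ideal J P" by simp
  have "I \<subseteq> J" unfolding Q'(3) eq using Q'(2) i by auto
  moreover have "J \<noteq> I"
  proof
    assume "J = I"
    then have "quot_dim K (ideal_radical P (Q i)) (carrier (quot_ring K (ideal_radical P (Q i)))) = 0"
      using J codim_self unfolding minimal_primary_divisor_def Let_def by simp
    moreover have "I \<subseteq> Q i" using eq i by blast
    ultimately show False using quot_dim_maximal_pos[OF radical_maximal[OF prim[OF i]]] by simp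
  qed
  ultimately show "I \<subset> J" by blast
qed

text \<open>Multiplication by \<open>j\<close> induces a \<open>K\<close>-linear isomorphism from
  P/(I : j) onto (I + jP)/I. The two quotients carry different copies of the scalars, which is why
  \<open>dimension_transfer\<close> compares only their actions.\<close>

lemma quot_dim_annihilator:
  assumes j: "j \<in> C" and M: "zero_dim_ideal K {g \<in> C. g * j \<in> I}"
  shows "codim (adjoin I j) = quot_dim K {g \<in> C. g * j \<in> I} (carrier (quot_ring K {g \<in> C. g * j \<in> I}))"
proof -
  define M where "M = {g \<in> C. g * j \<in> I}"
  interpret M: zero_dim_ideal K M unfolding M_def by (rule M)
  \<comment> \<open>A representative of the coset is chosen; the next fact shows that the value does
    not depend on it, because representatives differ by an element of I : j.\<close>
  define h where "h u = coset ((SOME g. g \<in> C \<and> M.coset g = u) * j)" for u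
  have h: "h (M.coset g) = coset (g * j)" if g: "g \<in> C" for g
  proof -
    define g' where "g' = (SOME g'. g' \<in> C \<and> M.coset g' = M.coset g)"
    have g': "g' \<in> C" "M.coset g' = M.coset g"
      using someI[of "\<lambda>g'. g' \<in> C \<and> M.coset g' = M.coset g" g] g unfolding g'_def by blast+
    then have "g' - g \<in> M" using g by (simp add: M.coset_eq_iff)
    then have "(g' - g) * j \<in> I" unfolding M_def by blast
    then have "g' * j - g * j \<in> I" unfolding left_diff_distrib .
    then have "coset (g' * j) = coset (g * j)" using g g'(1) j by (subst coset_eq_iff) simp_all
    then show ?thesis unfolding h_def g'_def .
  qed
  have car: "u \<in> carrier (quot_ring K M) \<longleftrightarrow> (\<exists>g\<in>C. u = M.coset g)" for u
    unfolding M.quot_carrier by blast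
  have smult: "h (M.coset (cst c) \<otimes>\<^bsub>quot_ring K M\<^esub> u) = coset (cst c) \<otimes>\<^bsub>quot_ring K I\<^esub> h u"
    if cu: "c \<in> K" "u \<in> carrier (quot_ring K M)" for c u
  proof -
    obtain g where g: "g \<in> C" "u = M.coset g" using cu(2) unfolding car by blast
    have "M.coset (cst c) \<otimes>\<^bsub>quot_ring K M\<^esub> u = M.coset (cst c * g)"
      unfolding g(2) using that(1) g(1) by (intro M.coset_mult) simp_all
    moreover have "coset (cst c) \<otimes>\<^bsub>quot_ring K I\<^esub> coset (g * j) = coset (cst c * (g * j))"
      using that(1) g(1) j by (intro coset_mult) simp_all
    ultimately show ?thesis using that(1) g by (simp only: h C_closed mult.assoc)
  qed
  have "Q.dimension (quot_dim K M (carrier (quot_ring K M))) (quot_scalars K I) (h ` carrier (quot_ring K M))"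
  proof (rule M.Q.dimension_transfer[OF Q.ring_axioms M.scalars_subfield subfieldE(3)[OF scalars_subfield]])
    show "h u \<in> carrier (quot_ring K I)" if "u \<in> carrier (quot_ring K M)" for u
      using that j unfolding car quot_carrier by (auto simp: h)
    show "inj_on h (carrier (quot_ring K M))"
    proof (rule inj_onI)
      fix u v assume uv: "u \<in> carrier (quot_ring K M)" "v \<in> carrier (quot_ring K M)" "h u = h v"
      then obtain f g where fg: "f \<in> C" "u = M.coset f" "g \<in> C" "v = M.coset g" unfolding car by blast
      then have "coset (f * j) = coset (g * j)" using uv(3) by (simp only: h)
      then have "f * j - g * j \<in> I" using fg j by (subst (asm) coset_eq_iff) simp_all
      then have "f - g \<in> M" using fg unfolding M_def left_diff_distrib[symmetric] by simp
      then show "u = v" unfolding fg(2,4) using fg(1,3) by (subst M.coset_eq_iff) simp_all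
    qed
    show "h (u \<oplus>\<^bsub>quot_ring K M\<^esub> v) = h u \<oplus>\<^bsub>quot_ring K I\<^esub> h v"
      if uv: "u \<in> carrier (quot_ring K M)" "v \<in> carrier (quot_ring K M)" for u v
    proof -
      obtain f g where fg: "f \<in> C" "u = M.coset f" "g \<in> C" "v = M.coset g" using uv unfolding car by blast
      have "u \<oplus>\<^bsub>quot_ring K M\<^esub> v = M.coset (f + g)"
        unfolding fg(2,4) using fg(1,3) by (intro M.coset_add)
      moreover have "coset (f * j) \<oplus>\<^bsub>quot_ring K I\<^esub> coset (g * j) = coset (f * j + g * j)"
        using fg(1,3) j by (intro coset_add) simp_all
      ultimately show ?thesis using fg by (simp only: h C_closed distrib_right)
    qed
    show "\<exists>b\<in>quot_scalars K I. \<forall>u\<in>carrier (quot_ring K M). h (a \<otimes>\<^bsub>quot_ring K M\<^esub> u) = b \<otimes>\<^bsub>quot_ring K I\<^esub> h u"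
      if "a \<in> quot_scalars K M" for a
      using that smult unfolding quot_scalars_def quot_img_def by blast
    show "\<exists>a\<in>quot_scalars K M. \<forall>u\<in>carrier (quot_ring K M). h (a \<otimes>\<^bsub>quot_ring K M\<^esub> u) = b \<otimes>\<^bsub>quot_ring K I\<^esub> h u"
      if "b \<in> quot_scalars K I" for b
      using that smult unfolding quot_scalars_def quot_img_def by blast
    show "M.Q.dimension (quot_dim K M (carrier (quot_ring K M))) (quot_scalars K M) (carrier (quot_ring K M))"
      unfolding M.dim_over by (rule M.Q.finite_dimensionE[OF M.scalars_subfield M.quot_finite])
  qed
  moreover have "h ` carrier (quot_ring K M) = quot_img K I (adjoin I j)"
  proof -
    have "coset (a + j * g) = coset (g * j)" if "a \<in> I" "g \<in> C" for a g
      using that j I_closed(2)[OF that(1)] by (subst coset_eq_iff) (auto simp: mult.commute)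
    moreover have "coset (g * j) \<in> coset ` adjoin I j" if "g \<in> C" for g
      using ideal_closed(5)[OF adjoin(1,3)[OF I j] that] by blast
    ultimately have "coset ` (adjoin I j) = (\<lambda>g. coset (g * j)) ` C"
      unfolding adjoin_def by (auto 0 3)
    moreover have "h ` carrier (quot_ring K M) = (\<lambda>g. coset (g * j)) ` C"
      unfolding M.quot_carrier image_image by (rule image_cong) (simp_all add: h)
    ultimately show ?thesis by (simp add: quot_img_def)
  qed
  ultimately show ?thesis
    unfolding M_def[symmetric] dim_over[of "quot_img K I (adjoin I j)"] using Q.dimI[OF scalars_subfield] by simp
qed

text \<open>By minimality any \<open>j\<close> in \<open>N\<close> outside \<open>I\<close>
  generates \<open>N\<close> modulo \<open>I\<close>, and its annihilator I : j is maximal. It is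
  the radical of each component omitting \<open>j\<close>, so there is just one such component;
  adjoining \<open>j\<close> to it yields \<open>N\<close>. The dimension is right because N/I is
  isomorphic to P/(I : j).\<close>

lemma minimal_ideal_divisor:
  assumes dec: "primary_decomposition P I s Q" and N: "ideal N P" "I \<subset> N"
    and min: "\<And>N'. ideal N' P \<Longrightarrow> I \<subset> N' \<Longrightarrow> N' \<subseteq> N \<Longrightarrow> N' = N"
  shows "\<exists>i\<in>{1..s}. minimal_primary_divisor K I s Q i N"
proof -
  have prim: "\<And>j. j \<in> {1..s} \<Longrightarrow> primary_ideal (Q j) P" and eq: "I = C \<inter> (\<Inter>i\<in>{1..s}. Q i)"
    and inj: "inj_on (\<lambda>i. ideal_radical P (Q i)) {1..s}"
    using dec unfolding primary_decomposition_def by blast+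
  obtain j where j: "j \<in> N" "j \<notin> I" using N(2) by blast
  have jC: "j \<in> C" using ideal_closed(2)[OF N(1) j(1)] .
  have gen: "N = adjoin I f" if f: "f \<in> N" "f \<notin> I" for f
  proof -
    note a = adjoin[OF I ideal_closed(2)[OF N(1) f(1)]]
    show ?thesis using min[OF a(1)] a(2,3) a(4)[OF N(1) _ f(1)] f N(2) by blast
  qed
  define M where "M = {g \<in> C. g * j \<in> I}"
  have M_mult: "a * b \<in> M" if "a \<in> M" "b \<in> C" for a b
    using that I_closed(4)[of "a * j" b] by (simp add: M_def mult_ac)
  have M_ideal: "ideal M P" unfolding ideal_iff
    using M_mult I_closed(1,3) by (auto simp: M_def distrib_right)
  have IM: "I \<subseteq> M" using jC I_closed(2,4) by (auto simp: M_def)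
  have MC: "M \<noteq> C"
  proof
    assume "M = C"
    then have "1 \<in> M" by simp
    then show False using j(2) by (simp add: M_def)
  qed
  have M: "maximal M"
    unfolding maximal_def
  proof (intro conjI allI impI M_ideal IM MC)
    fix N' assume N': "ideal N' P" "M \<subseteq> N'"
    show "N' = M \<or> N' = C"
    proof (rule disjCI)
      assume "N' \<noteq> C"
      show "N' = M"
      proof (rule ccontr)
        assume "N' \<noteq> M"
        then obtain g where g: "g \<in> N'" "g \<notin> M" using N'(2) by blast
        have gC: "g \<in> C" using ideal_closed(2)[OF N'(1) g(1)] .
        have "g * j \<in> N" "g * j \<notin> I" using ideal_closed(5)[OF N(1) j(1) gC] g(2) gC by (auto simp: M_def)
        \<comment> \<open>Since \<open>g * j\<close> generates \<open>N\<close> as well,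
          \<open>j\<close> is a multiple of it modulo \<open>I\<close>. The resulting
          \<open>1 - g * p\<close> annihilates \<open>j\<close> modulo \<open>I\<close>, and this
          forces 1 into \<open>N'\<close>.\<close>
        then have "j \<in> adjoin I (g * j)" using gen j(1) by blast
        then obtain a p where ap: "a \<in> I" "p \<in> C" "j = a + g * j * p" unfolding adjoin_def by blast
        have "(1 - g * p) * j = j - g * j * p" by (simp add: algebra_simps)
        then have "(1 - g * p) * j = a" using ap(3) by (metis add_diff_cancel_right')
        then have "1 - g * p \<in> M" using ap gC by (simp add: M_def)
        then have "1 - g * p + g * p \<in> N'"
          using N'(2) ideal_closed(3)[OF N'(1)] ideal_closed(4)[OF N'(1) g(1) ap(2)] by blast
        then show False using one_notin_proper[OF N'(1) \<open>N' \<noteq> C\<close>] by simp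
      qed
    qed
  qed
  have rad: "M = ideal_radical P (Q k)" if k: "k \<in> {1..s}" "j \<notin> Q k" for k
  proof -
    have "I \<subseteq> Q k" using eq k(1) by blast
    have "\<exists>m. g ^ m \<in> Q k" if g: "g \<in> M" for g
    proof -
      have "g \<in> C" "j * g \<in> Q k" using g \<open>I \<subseteq> Q k\<close> by (auto simp: M_def mult.commute)
      then show ?thesis using prim[OF k(1)] k(2) jC unfolding primary_iff by blast
    qed
    then have "M \<subseteq> ideal_radical P (Q k)"
      unfolding radical_eq using ideal_closed(2)[OF M_ideal] by blast
    then show ?thesis using maximal_incl[OF M radical_maximal[OF prim[OF k(1)] \<open>I \<subseteq> Q k\<close>]] by blast
  qed
  obtain i where i: "i \<in> {1..s}" "j \<notin> Q i" using j(2) jC eq by blast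
  \<comment> \<open>Two components omitting \<open>j\<close> would share the radical
    \<open>M\<close>, whereas a minimal decomposition has distinct radicals.\<close>
  have other: "j \<in> Q k" if "k \<in> {1..s}" "k \<noteq> i" for k
    using rad[OF i] rad[OF that(1)] inj_onD[OF inj _ i(1) that(1)] that(2) by metis
  have Qi: "ideal (Q k) P" if "k \<in> {1..s}" for k using prim[OF that] by (simp add: primary_iff)
  define Q' where "Q' = adjoin (Q i) j"
  note Q' = adjoin[OF Qi[OF i(1)] jC, folded Q'_def]
  have NQ: "N = (\<Inter>k\<in>{1..s}. (Q(i := Q')) k)"
  proof
    have "adjoin I j \<subseteq> (Q(i := Q')) k" if k: "k \<in> {1..s}" for k
    proof (cases "k = i")
      case True
      have "I \<subseteq> Q'" using eq Q'(2) i(1) by blast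
      then show ?thesis using adjoin(4)[OF I jC Q'(1)] Q'(3) True by simp
    next
      case False
      have "I \<subseteq> Q k" using eq k by blast
      then show ?thesis using adjoin(4)[OF I jC Qi[OF k]] other[OF k] False by simp
    qed
    then show "N \<subseteq> (\<Inter>k\<in>{1..s}. (Q(i := Q')) k)" using gen[OF j] by blast
    show "(\<Inter>k\<in>{1..s}. (Q(i := Q')) k) \<subseteq> N"
    proof
      fix f assume f: "f \<in> (\<Inter>k\<in>{1..s}. (Q(i := Q')) k)"
      then have fQ: "f \<in> Q k" if "k \<in> {1..s}" "k \<noteq> i" for k using that by (auto dest: bspec[of _ _ k])
      have "f \<in> Q'" using f i(1) by (auto dest: bspec[of _ _ i])
      \<comment> \<open>A modular-law argument: \<open>f\<close> and \<open>j * p\<close> lie in all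
        the other components, so \<open>a\<close> does too, and hence \<open>a\<close> is in
        \<open>I\<close>.\<close>
      then obtain a p where ap: "a \<in> Q i" "p \<in> C" "f = a + j * p" unfolding Q'_def adjoin_def by blast
      have "a \<in> Q k" if k: "k \<in> {1..s}" for k
      proof (cases "k = i")
        case False
        then have "f - j * p \<in> Q k"
          using ideal_closed(7)[OF Qi[OF k] fQ[OF k] ideal_closed(4)[OF Qi[OF k] other[OF k] ap(2)]] by blast
        then show ?thesis using ap(3) by simp
      qed (use ap in simp)
      then have "a \<in> I" using eq ideal_closed(2)[OF Qi[OF i(1)] ap(1)] by blast
      then show "f \<in> N" unfolding gen[OF j] adjoin_def using ap by blast
    qed
  qed
  have "Q i \<subset> Q'" using Q'(2,3) i(2) by blast
  with Q'(1) NQ have "primary_divisor P s Q i N" unfolding primary_divisor_def by blast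
  moreover have "zero_dim_ideal K M"
    using zero_dimensional_mono[OF zero_dim M_ideal IM MC]
    by (intro zero_dim_ideal.intro proper_ideal.intro zero_dim_ideal_axioms.intro K M_ideal MC)
  then have "codim N = quot_dim K M (carrier (quot_ring K M))"
    using quot_dim_annihilator[OF jC, folded M_def] gen[OF j] by simp
  ultimately have "minimal_primary_divisor K I s Q i N"
    unfolding minimal_primary_divisor_def Let_def using rad[OF i] by simp
  then show ?thesis using i(1) by blast
qed

end

section \<open>The Cayley-Bacharach property in terms of the filtration\<close>

context zero_dim_ideal begin

abbreviation F :: "int \<Rightarrow> ('x, 'l) mpoly set" where "F \<equiv> poly_filt K"

text \<open>This is F_i P + I, the preimage of F_i R; orders and values of the Hilbert function
  become membership questions among polynomials.\<close>

definition filt :: "int \<Rightarrow> ('x, 'l) mpoly set" where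
  "filt i = {f \<in> C. \<exists>g\<in>F i. f - g \<in> I}"

lemma poly_filt_eq_C:
  "F i = {f \<in> C. \<forall>m\<in>Poly_Mapping.keys f. int (mon_deg m) \<le> i}"
  by (rule poly_filt_eq[OF K_simps(1)])

lemma poly_filt_sub: "F i \<subseteq> C"
  unfolding poly_filt_eq_C by blast

lemma poly_filt_subspace: "subspace_over K (F i)"
proof -
  have "f + g \<in> F i" if "f \<in> F i" "g \<in> F i" for f g
    using that keys_add[of f g] unfolding poly_filt_eq_C by auto
  moreover have "cst k * f \<in> F i" if "k \<in> K" "f \<in> F i" for k f
  proof -
    have "Poly_Mapping.keys (cst k * f) \<subseteq> Poly_Mapping.keys f"
      using keys_mult[of "cst k" f] by (auto split: if_splits)
    then show ?thesis using that unfolding poly_filt_eq_C by auto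
  qed
  moreover have "0 \<in> F i" unfolding poly_filt_eq_C by simp
  ultimately show ?thesis unfolding subspace_over_def using poly_filt_sub by blast
qed

lemma filt_subspace: "subspace_over K (filt i)"
proof -
  note Fs = poly_filt_subspace[of i, unfolded subspace_over_def]
  have add: "f + g \<in> filt i" if fg: "f \<in> filt i" "g \<in> filt i" for f g
  proof -
    from fg obtain a b where ab: "f \<in> C" "g \<in> C" "a \<in> F i" "b \<in> F i" "f - a \<in> I" "g - b \<in> I"
      unfolding filt_def by blast
    have "f - a + (g - b) \<in> I" by (rule I_closed(3)[OF ab(5,6)])
    then have "f + g - (a + b) \<in> I" by (simp add: algebra_simps)
    moreover have "a + b \<in> F i" using Fs ab by blast
    ultimately show ?thesis unfolding filt_def using ab(1,2) by auto
  qed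
  have smult: "cst k * f \<in> filt i" if kf: "k \<in> K" "f \<in> filt i" for k f
  proof -
    from kf(2) obtain a where a: "f \<in> C" "a \<in> F i" "f - a \<in> I" unfolding filt_def by blast
    have "cst k * (f - a) \<in> I" using I_closed(5)[OF a(3)] kf(1) by simp
    then have "cst k * f - cst k * a \<in> I" by (simp add: right_diff_distrib)
    moreover have "cst k * a \<in> F i" using Fs a kf by blast
    ultimately show ?thesis unfolding filt_def using a(1) kf(1) by auto
  qed
  have "0 \<in> filt i" using Fs I_closed(1) unfolding filt_def by (auto intro!: bexI[of _ 0])
  then show ?thesis unfolding subspace_over_def using add smult by (auto simp: filt_def)
qed

lemma I_sub_filt: "I \<subseteq> filt i"
proof
  fix f assume f: "f \<in> I"
  then have "f - 0 \<in> I" "0 \<in> F i" using poly_filt_subspace[of i] by (simp_all add: subspace_over_def)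
  then show "f \<in> filt i" using I_closed(2)[OF f] unfolding filt_def by blast
qed

lemma filt_sub: "filt i \<subseteq> C"
  by (auto simp: filt_def)

lemma filt_mono: "i \<le> j \<Longrightarrow> filt i \<subseteq> filt j"
proof -
  assume "i \<le> j"
  then have "F i \<subseteq> F j" unfolding poly_filt_eq_C by (auto intro: order_trans)
  then show ?thesis unfolding filt_def by blast
qed

lemma filt_neg:
  assumes "i < 0"
  shows "filt i = I"
proof -
  have "F i = {0}"
    using assms by (auto simp: poly_filt_def)
  then show ?thesis using I_closed(2) by (auto simp: filt_def)
qed

lemma coset_mem_quot_filt: "f \<in> C \<Longrightarrow> coset f \<in> quot_filt K I i \<longleftrightarrow> f \<in> filt i"
  unfolding quot_filt_def using quot_img_mem_iff[OF _ poly_filt_sub] by (simp add: filt_def)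

lemma quot_filt_eq: "quot_filt K I i = quot_img K I (filt i)"
proof -
  have "F i \<subseteq> filt i" using poly_filt_sub I_closed(1) by (auto simp: filt_def intro!: bexI)
  then have "quot_filt K I i \<subseteq> quot_img K I (filt i)" unfolding quot_filt_def quot_img_def by blast
  moreover have "quot_img K I (filt i) \<subseteq> quot_filt K I i"
    using coset_mem_quot_filt filt_sub unfolding quot_img_def by blast
  ultimately show ?thesis by blast
qed

lemma affine_HF_full_iff:
  "affine_HF K I i = quot_dim K I (carrier (quot_ring K I)) \<longleftrightarrow> filt i = C"
proof -
  have C: "carrier (quot_ring K I) = quot_img K I C" by (simp add: quot_carrier quot_img_def)
  show ?thesis unfolding affine_HF_def quot_filt_eq C
    using codim_less[OF filt_subspace ideal_subspace[OF C_ideal] I_sub_filt, of i] filt_sub[of i] by fastforce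
qed

lemma exists_filt_full: "\<exists>i. filt i = C"
proof -
  from zero_dim obtain S where S: "S \<subseteq> C" "finite S"
    "\<And>V. subspace_over K V \<Longrightarrow> I \<subseteq> V \<Longrightarrow> S \<subseteq> V \<Longrightarrow> V = C"
    unfolding zero_dimensional_iff by blast
  define E where "E = (\<Union>f\<in>S. mon_deg ` Poly_Mapping.keys f)"
  have "finite E" using S(2) by (simp add: E_def)
  \<comment> \<open>If \<open>E\<close> is empty, \<open>Max E\<close> is unspecified, but then no
    polynomial in \<open>S\<close> has a monomial to be tested.\<close>
  have "S \<subseteq> filt (int (Max E))"
  proof
    fix f assume f: "f \<in> S"
    have "int (mon_deg m) \<le> int (Max E)" if "m \<in> Poly_Mapping.keys f" for m
      using that f \<open>finite E\<close> by (auto simp: E_def intro!: Max_ge)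
    then have "f \<in> F (int (Max E))" using f S(1) unfolding poly_filt_eq_C by blast
    then show "f \<in> filt (int (Max E))" using f S(1) I_closed(1) unfolding filt_def by (auto intro!: bexI[of _ f])
  qed
  then show ?thesis using S(3)[OF filt_subspace I_sub_filt] by blast
qed

text \<open>The sets \<open>filt i\<close> increase with \<open>i\<close>, so "for all j from i on"
  collapses to i itself. Below degree 0 they equal the proper ideal \<open>I\<close>, which bounds
  the minimum from below.\<close>

lemma reg_index_le_iff: "reg_index K I \<le> i \<longleftrightarrow> filt i = C"
proof -
  have mono: "filt j = C" if "filt i = C" "i \<le> j" for i j
    using filt_mono[OF that(2)] filt_sub[of j] that(1) by blast
  obtain i0 where i0: "filt i0 = C" using exists_filt_full by blast
  have "reg_index K I \<le> i \<longleftrightarrow> (\<forall>j\<ge>i. filt j = C)"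
    unfolding reg_index_def affine_HF_full_iff
  proof (rule Least_int_le_iff)
    show "\<not> (\<forall>j\<ge>i. filt j = C)" if "i < 0" for i
      using filt_neg[OF that] proper by auto
    show "\<forall>j\<ge>i0. filt j = C" using mono[OF i0] by blast
  qed auto
  then show ?thesis using mono by blast
qed

lemma filt_ord_le_iff:
  assumes f: "f \<in> C" "f \<notin> I"
  shows "filt_ord K I (coset f) \<le> i \<longleftrightarrow> f \<in> filt i"
proof -
  obtain i0 where i0: "filt i0 = C" using exists_filt_full by blast
  show ?thesis unfolding filt_ord_def coset_mem_quot_filt[OF f(1)]
  proof (rule Least_int_le_iff)
    show "f \<notin> filt i" if "i < 0" for i using filt_neg[OF that] f(2) by simp
    show "f \<in> filt i0" using i0 f(1) by simp
  qed (use filt_mono in blast)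
qed

text \<open>At ri(R) the filtration is already everything, so all orders are at most ri(R), and the
  maximum reaches it unless every order is at most ri(R) - 1.\<close>

lemma reg_index_ideal_eq_iff:
  assumes J: "ideal J P" "I \<subset> J"
  shows "reg_index_ideal K I J = reg_index K I \<longleftrightarrow> \<not> J \<subseteq> filt (reg_index K I - 1)"
proof -
  define r where "r = reg_index K I"
  define E where "E = (\<lambda>f. filt_ord K I (coset f)) ` (J - I)"
  have JC: "f \<in> C" if "f \<in> J" for f using ideal_closed(2)[OF J(1) that] .
  have "quot_img K I J - {\<zero>\<^bsub>quot_ring K I\<^esub>} = coset ` (J - I)"
  proof -
    have "coset f = coset 0 \<longleftrightarrow> f \<in> I" if "f \<in> J" for f
      using JC[OF that] by (subst coset_eq_iff) simp_all
    then show ?thesis unfolding quot_img_def quot_zero by blast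
  qed
  then have RE: "reg_index_ideal K I J = Max E"
    unfolding reg_index_ideal_def E_def by (simp add: image_image)
  \<comment> \<open>The set J/I may be infinite; confining its orders to a finite interval is what
    gives \<open>Max\<close> a meaning.\<close>
  have "e \<in> {0..r}" if e: "e \<in> E" for e
  proof -
    obtain f where f: "f \<in> J" "f \<notin> I" "e = filt_ord K I (coset f)" using e unfolding E_def by blast
    have iff: "e \<le> i \<longleftrightarrow> f \<in> filt i" for i
      unfolding f(3) by (rule filt_ord_le_iff[OF JC[OF f(1)] f(2)])
    have "\<not> e \<le> - 1" unfolding iff using filt_neg[of "- 1"] f(2) by simp
    moreover have "filt r = C" using reg_index_le_iff[of r] unfolding r_def by blast
    then have "e \<le> r" unfolding iff using JC[OF f(1)] by blast
    ultimately show ?thesis by simp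
  qed
  then have E: "finite E" "\<And>e. e \<in> E \<Longrightarrow> e \<le> r" by (auto intro: finite_subset[of E "{0..r}"])
  have "E \<noteq> {}" using J(2) unfolding E_def by blast
  have "Max E = r \<longleftrightarrow> r \<in> E"
    using Max_in[OF E(1) \<open>E \<noteq> {}\<close>] Max_eqI[OF E(1), of r] E(2) by metis
  also have "\<dots> \<longleftrightarrow> (\<exists>e\<in>E. \<not> e \<le> r - 1)"
    using E(2) by force
  also have "\<dots> \<longleftrightarrow> (\<exists>f\<in>J - I. f \<notin> filt (r - 1))"
  proof -
    have "filt_ord K I (coset f) \<le> r - 1 \<longleftrightarrow> f \<in> filt (r - 1)" if "f \<in> J - I" for f
      using that by (intro filt_ord_le_iff JC) auto
    then show ?thesis unfolding E_def by blast
  qed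
  also have "\<dots> \<longleftrightarrow> \<not> J \<subseteq> filt (r - 1)"
    using I_sub_filt by blast
  finally show ?thesis unfolding RE r_def .
qed

text \<open>A witness \<open>f\<close> means that the nonzero ideal (I + fP)/I lies inside the
  filtration step. A minimal ideal below it is a divisor for whichever decomposition the existential
  supplies. In the converse direction a decomposition has to be produced, and a divisor matters only
  as an ideal properly above \<open>I\<close>.\<close>

lemma cayley_bacharach_iff:
  "cayley_bacharach K I \<longleftrightarrow> \<not> (\<exists>f\<in>C - I. \<forall>g\<in>C. f * g \<in> filt (reg_index K I - 1))"
proof
  assume "cayley_bacharach K I"
  then obtain s Q where dec: "primary_decomposition P I s Q"
    and cb: "\<And>i J. i \<in> {1..s} \<Longrightarrow> minimal_primary_divisor K I s Q i J \<Longrightarrow>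
      reg_index_ideal K I J = reg_index K I"
    unfolding cayley_bacharach_def by blast
  show "\<not> (\<exists>f\<in>C - I. \<forall>g\<in>C. f * g \<in> filt (reg_index K I - 1))"
  proof
    assume "\<exists>f\<in>C - I. \<forall>g\<in>C. f * g \<in> filt (reg_index K I - 1)"
    then obtain f where f: "f \<in> C" "f \<notin> I" "\<And>g. g \<in> C \<Longrightarrow> f * g \<in> filt (reg_index K I - 1)" by blast
    note a = adjoin[OF I f(1)]
    have "adjoin I f \<subseteq> filt (reg_index K I - 1)"
    proof
      fix u assume "u \<in> adjoin I f"
      then obtain b g where bg: "b \<in> I" "g \<in> C" "u = b + f * g" unfolding adjoin_def by blast
      then show "u \<in> filt (reg_index K I - 1)"
        using filt_subspace[of "reg_index K I - 1"] f(3)[OF bg(2)] I_sub_filt[of "reg_index K I - 1"]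
        unfolding subspace_over_def by blast
    qed
    moreover obtain N where N: "ideal N P" "I \<subset> N" "N \<subseteq> adjoin I f"
      and min: "\<And>N'. ideal N' P \<Longrightarrow> I \<subset> N' \<Longrightarrow> N' \<subseteq> N \<Longrightarrow> N' = N"
    proof -
      have "I \<subset> adjoin I f" using a(2,3) f(2) by blast
      then show thesis using exists_minimal[OF a(1)] that by metis
    qed
    moreover obtain i where i: "i \<in> {1..s}" "minimal_primary_divisor K I s Q i N"
      using minimal_ideal_divisor[OF dec N(1,2) min] by blast
    ultimately show False
      using cb[OF i] reg_index_ideal_eq_iff[OF N(1,2)] by blast
  qed
next
  assume no: "\<not> (\<exists>f\<in>C - I. \<forall>g\<in>C. f * g \<in> filt (reg_index K I - 1))"
  obtain s Q where dec: "primary_decomposition P I s Q" using exists_primary_decomposition by blast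
  have "reg_index_ideal K I J = reg_index K I"
    if i: "i \<in> {1..s}" and J: "minimal_primary_divisor K I s Q i J" for i J
  proof -
    note J = minimal_primary_divisor_ideal[OF dec i J]
    obtain f where f: "f \<in> J" "f \<notin> I" using J(2) by blast
    have "\<not> J \<subseteq> filt (reg_index K I - 1)"
    proof
      assume "J \<subseteq> filt (reg_index K I - 1)"
      then have "\<forall>g\<in>C. f * g \<in> filt (reg_index K I - 1)" using ideal_closed(4)[OF J(1) f(1)] by blast
      then show False using no ideal_closed(2)[OF J(1) f(1)] f(2) by blast
    qed
    then show ?thesis using reg_index_ideal_eq_iff[OF J] by blast
  qed
  then show "cayley_bacharach K I" unfolding cayley_bacharach_def using dec by blast
qed

end

section \<open>Extension of the base field\<close>

text \<open>The linear span over the ambient field.\<close>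

inductive_set lspan :: "('x, 'l::field) mpoly set \<Rightarrow> ('x, 'l) mpoly set" for V where
  zero: "0 \<in> lspan V"
| add: "f \<in> lspan V \<Longrightarrow> v \<in> V \<Longrightarrow> f + cst a * v \<in> lspan V"

lemma carrier_mpoly_ring_UNIV [simp]: "carrier (mpoly_ring UNIV) = UNIV"
  by (auto simp: mpoly_ring_simps(1))

lemma subfield_UNIV: "subfield UNIV (ring_of_type_algebra :: 'l::field ring)"
proof -
  interpret field "ring_of_type_algebra :: 'l ring" by (rule field_from_type_algebra)
  show ?thesis using carrier_is_subfield by (simp add: ring_of_type_algebra_def)
qed

lemma lspan_base: "v \<in> V \<Longrightarrow> v \<in> lspan V"
  using lspan.add[OF lspan.zero, of v V 1] by simp

lemma lspan_plus: "f \<in> lspan V \<Longrightarrow> g \<in> lspan V \<Longrightarrow> f + g \<in> lspan V"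
proof (rotate_tac 1, induction g rule: lspan.induct)
  case (add g v a)
  then show ?case using lspan.add[of "f + g" V v a] by (simp add: add.assoc)
qed simp

lemma lspan_smult: "f \<in> lspan V \<Longrightarrow> cst c * f \<in> lspan V"
proof (induction f rule: lspan.induct)
  case (add f v a)
  have "cst c * (f + cst a * v) = cst c * f + cst (c * a) * v"
    by (simp add: distrib_left mult_single flip: mult.assoc)
  then show ?case using lspan.add[OF add.IH add.hyps(2), of "c * a"] by simp
qed (simp add: lspan.zero)

lemma lspan_subspace: "subspace_over UNIV (lspan V)"
  unfolding subspace_over_def by (simp add: lspan.zero lspan_plus lspan_smult)

lemma lspan_min: "subspace_over UNIV W \<Longrightarrow> V \<subseteq> W \<Longrightarrow> lspan V \<subseteq> W"
proof
  fix f assume W: "subspace_over UNIV W" "V \<subseteq> W" and "f \<in> lspan V"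
  from this(3) show "f \<in> W"
    by (induction f rule: lspan.induct) (use W in \<open>auto simp: subspace_over_def\<close>)
qed

lemma single_split: "Poly_Mapping.single m c = cst c * Poly_Mapping.single m (1::'a::field)"
  for m :: "'x \<Rightarrow>\<^sub>0 nat"
  by (simp add: mult_single)

lemma mem_lspan_monomials: "f \<in> lspan ((\<lambda>m. Poly_Mapping.single m 1) ` Poly_Mapping.keys f)"
  (is "f \<in> lspan ?S")
proof -
  have "(\<Sum>m\<in>M. Poly_Mapping.single m (Poly_Mapping.lookup f m)) \<in> lspan ?S" if "finite M" "M \<subseteq> Poly_Mapping.keys f" for M
    using that
  proof (induction M)
    case (insert m M)
    then have "cst (Poly_Mapping.lookup f m) * Poly_Mapping.single m 1 \<in> lspan ?S"
      by (intro lspan_smult lspan_base) auto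
    then show ?case using insert by (simp add: lspan_plus flip: single_split)
  qed (simp add: lspan.zero)
  from this[OF finite_keys order_refl] show ?thesis unfolding poly_mapping_sum_single[of f, symmetric] .
qed

context proper_ideal begin

lemma monomial_mem_C: "Poly_Mapping.single m 1 \<in> C"
  using K_simps by (simp add: mpoly_ring_simps(1) lookup_single when_def)

lemma lspan_C: "lspan C = UNIV"
proof -
  have "lspan ((\<lambda>m. Poly_Mapping.single m 1) ` Poly_Mapping.keys f) \<subseteq> lspan C" for f :: "('x, 'l) mpoly"
    using monomial_mem_C lspan_base by (intro lspan_min lspan_subspace) blast
  then show ?thesis using mem_lspan_monomials by blast
qed

text \<open>Polynomials over the ambient field are combinations of polynomials over
  \<open>K\<close>, so the span of \<open>I\<close> is already closed under multiplication by them.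
  The extended ideal thereby becomes a purely linear object.\<close>

lemma genideal_eq_lspan: "Idl\<^bsub>mpoly_ring UNIV\<^esub> I = lspan I"
proof -
  interpret L: cring "mpoly_ring UNIV :: ('x, 'l) mpoly ring" by (rule mpoly_ring_cring[OF subfield_UNIV])
  have mult: "f * g \<in> lspan I" if "f \<in> lspan I" for f g
    using that
  proof (induction f rule: lspan.induct)
    case (add f v a)
    have "v * h \<in> lspan I" if "h \<in> lspan C" for h using that
    proof (induction h rule: lspan.induct)
      case (add h w b)
      have "v * w \<in> I" by (rule I_closed(4)) fact+
      then have "cst b * (v * w) \<in> lspan I" by (intro lspan_smult lspan_base)
      then have "v * h + cst b * (v * w) \<in> lspan I" using add.IH by (rule lspan_plus[rotated])
      then show ?case by (simp add: algebra_simps)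
    qed (simp add: lspan.zero)
    then have "cst a * (v * g) \<in> lspan I" using lspan_C by (intro lspan_smult) simp
    then have "f * g + cst a * (v * g) \<in> lspan I" using add.IH by (rule lspan_plus[rotated])
    then show ?case by (simp add: distrib_right mult.assoc)
  qed (simp add: lspan.zero)
  have "ideal (lspan I) (mpoly_ring UNIV)"
    unfolding ideal_mpoly_ring_iff[OF subfield_UNIV] by (simp add: lspan.zero lspan_plus mult)
  then have "Idl\<^bsub>mpoly_ring UNIV\<^esub> I \<subseteq> lspan I"
    by (rule L.genideal_minimal) (use lspan_base in blast)
  moreover have "lspan I \<subseteq> Idl\<^bsub>mpoly_ring UNIV\<^esub> I"
  proof (rule lspan_min)
    have "ideal (Idl\<^bsub>mpoly_ring UNIV\<^esub> I) (mpoly_ring UNIV)" by (rule L.genideal_ideal) simp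
    then show "subspace_over UNIV (Idl\<^bsub>mpoly_ring UNIV\<^esub> I)"
      unfolding ideal_mpoly_ring_iff[OF subfield_UNIV] subspace_over_def by (simp add: mult.commute)
    show "I \<subseteq> Idl\<^bsub>mpoly_ring UNIV\<^esub> I" by (rule L.genideal_self) simp
  qed
  ultimately show ?thesis by blast
qed

end

section \<open>The retraction applied to coefficients\<close>

locale retraction = zero_dim_ideal K I
  for K :: "'l::field set" and I :: "('x, 'l) mpoly set" +
  fixes \<phi> :: "'l \<Rightarrow> 'l"
  assumes phi_mem: "\<phi> a \<in> K" and phi_add: "\<phi> (a + b) = \<phi> a + \<phi> b"
    and phi_mult: "k \<in> K \<Longrightarrow> \<phi> (k * a) = k * \<phi> a" and phi_one: "\<phi> 1 = 1"
begin

lemma phi_zero [simp]: "\<phi> 0 = 0"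
  using phi_mult[of 0 0] K_simps by simp

lemma phi_K: "k \<in> K \<Longrightarrow> \<phi> k = k"
  using phi_mult[of k 1] phi_one by simp

definition \<Phi> :: "('x, 'l) mpoly \<Rightarrow> ('x, 'l) mpoly" where
  "\<Phi> f = Poly_Mapping.map \<phi> f"

text \<open>\<open>Poly_Mapping.map\<close> keeps zero coefficients at zero; \<open>phi_zero\<close>
  makes the formula correct there as well.\<close>

lemma lookup_\<Phi>: "Poly_Mapping.lookup (\<Phi> f) m = \<phi> (Poly_Mapping.lookup f m)"
  unfolding \<Phi>_def by (simp add: Poly_Mapping.map.rep_eq when_def)

lemma \<Phi>_mem: "\<Phi> f \<in> C"
  by (simp add: mpoly_ring_simps(1) lookup_\<Phi> phi_mem)

lemma \<Phi>_zero [simp]: "\<Phi> 0 = 0"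
  by (rule poly_mapping_eqI) (simp add: lookup_\<Phi>)

lemma \<Phi>_add: "\<Phi> (f + g) = \<Phi> f + \<Phi> g"
  by (rule poly_mapping_eqI) (simp add: lookup_\<Phi> lookup_add phi_add)

lemma \<Phi>_diff: "\<Phi> (f - g) = \<Phi> f - \<Phi> g"
  using \<Phi>_add[of "f - g" g] by (simp add: algebra_simps)

lemma \<Phi>_C: "f \<in> C \<Longrightarrow> \<Phi> f = f"
  by (rule poly_mapping_eqI) (simp add: lookup_\<Phi> mpoly_ring_simps(1) phi_K)

lemma \<Phi>_single: "\<Phi> (Poly_Mapping.single m a) = Poly_Mapping.single m (\<phi> a)"
  by (rule poly_mapping_eqI) (simp add: lookup_\<Phi> lookup_single when_def)

lemma \<Phi>_mult:
  assumes "g \<in> C"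
  shows "\<Phi> (f * g) = \<Phi> f * g"
proof (induction f rule: poly_mapping_additive_induct)
  case (single m)
  have g: "Poly_Mapping.lookup g n \<in> K" for n using assms by (simp add: mpoly_ring_simps(1))
  show ?case
  proof (induction g rule: poly_mapping_additive_induct)
    case (single n)
    have "\<phi> (a * Poly_Mapping.lookup g n) = \<phi> a * Poly_Mapping.lookup g n" for a
      using phi_mult[OF g, of n a] by (simp add: mult.commute)
    then show ?case by (simp add: mult_single \<Phi>_single)
  qed (simp_all add: \<Phi>_add distrib_left)
qed (simp_all add: \<Phi>_add distrib_right)

lemma \<Phi>_lspan:
  assumes V: "subspace_over K V" and f: "f \<in> lspan V"
  shows "\<Phi> f \<in> V"
  using f
proof (induction f rule: lspan.induct)
  case (add f v a)
  have v: "v \<in> C" using V add.hyps(2) unfolding subspace_over_def by blast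
  have "\<Phi> (f + cst a * v) = \<Phi> f + cst (\<phi> a) * v"
    by (simp add: \<Phi>_add \<Phi>_mult[OF v] \<Phi>_single)
  then show ?case using add V phi_mem unfolding subspace_over_def by simp
qed (use V in \<open>simp add: subspace_over_def\<close>)

lemma \<Phi>_ideal: "f \<in> lspan I \<Longrightarrow> \<Phi> f \<in> I"
  by (rule \<Phi>_lspan[OF ideal_subspace[OF I]])

text \<open>By induction on the number of monomials, \<open>f\<close> lies in the span of a \<open>K\<close>-subspace \<open>W\<close>. If
  \<open>f = g + l s\<close> with \<open>g\<close> in the span of \<open>W\<close> and \<open>l \<noteq> 0\<close>, then the hypothesis for \<open>a = 1/l\<close> shows that
  already \<open>s \<in> W\<close>.\<close>

lemma retraction_detects:
  assumes f: "\<And>a. \<Phi> (cst a * f) \<in> I"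
  shows "f \<in> lspan I"
proof -
  have "\<exists>W. subspace_over K W \<and> I \<subseteq> W \<and> S \<subseteq> W \<and> (\<forall>f\<in>lspan W. (\<forall>a. \<Phi> (cst a * f) \<in> I) \<longrightarrow> f \<in> lspan I)"
    if "finite S" "S \<subseteq> C" for S
    using that
  proof (induction S)
    case empty
    then show ?case using ideal_subspace[OF I] by blast
  next
    case (insert s S)
    then obtain W where W: "subspace_over K W" "I \<subseteq> W" "S \<subseteq> W"
      and IH: "\<And>f. f \<in> lspan W \<Longrightarrow> (\<And>a. \<Phi> (cst a * f) \<in> I) \<Longrightarrow> f \<in> lspan I" by auto
    note Ws = W(1)[unfolded subspace_over_def]
    have s: "s \<in> C" using insert.prems by simp
    define W' where "W' = {w + cst k * s | w k. w \<in> W \<and> k \<in> K}"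
    have W'I: "w + cst k * s \<in> W'" if "w \<in> W" "k \<in> K" for w k using that unfolding W'_def by blast
    have add: "u + v \<in> W'" if uv: "u \<in> W'" "v \<in> W'" for u v
    proof -
      from uv obtain w k w' k' where "w \<in> W" "k \<in> K" "u = w + cst k * s" "w' \<in> W" "k' \<in> K" "v = w' + cst k' * s"
        unfolding W'_def by blast
      then show ?thesis using W'I[of "w + w'" "k + k'"] Ws K_simps(3) by (simp add: single_add algebra_simps)
    qed
    have smult: "cst c * u \<in> W'" if cu: "c \<in> K" "u \<in> W'" for c u
    proof -
      from cu(2) obtain w k where "w \<in> W" "k \<in> K" "u = w + cst k * s" unfolding W'_def by blast
      moreover have "cst c * (cst k * s) = cst (c * k) * s" by (simp add: mult_single flip: mult.assoc)
      ultimately show ?thesis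
        using W'I[of "cst c * w" "c * k"] Ws K_simps(4) cu(1) by (simp add: distrib_left)
    qed
    have WW': "W \<subseteq> W'"
    proof
      fix w assume "w \<in> W"
      then show "w \<in> W'" using W'I[of w 0] K_simps(1) by simp
    qed
    have "W' \<subseteq> C" using Ws s unfolding W'_def by auto
    then have sub: "subspace_over K W'" using add smult WW' Ws unfolding subspace_over_def by blast
    have "s \<in> W'" using W'I[of 0 1] Ws K_simps(2) by simp
    have split: "\<exists>g\<in>lspan W. \<exists>l. f = g + cst l * s" if "f \<in> lspan W'" for f
      using that
    proof (induction f rule: lspan.induct)
      case zero
      show ?case by (intro bexI[of _ 0] exI[of _ 0] lspan.zero) simp
    next
      case (add f v a)
      then obtain g l w k where "g \<in> lspan W" "f = g + cst l * s" "w \<in> W" "v = w + cst k * s"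
        unfolding W'_def by blast
      moreover have "cst a * (cst k * s) = cst (a * k) * s" by (simp add: mult_single flip: mult.assoc)
      ultimately have "f + cst a * v = (g + cst a * w) + cst (l + a * k) * s"
        by (simp add: single_add algebra_simps)
      moreover have "g + cst a * w \<in> lspan W" by (rule lspan.add) fact+
      ultimately show ?case by blast
    qed
    have "f \<in> lspan I" if f: "f \<in> lspan W'" "\<And>a. \<Phi> (cst a * f) \<in> I" for f
    proof -
      from split[OF f(1)] obtain g l where g: "g \<in> lspan W" "f = g + cst l * s" by blast
      have "f \<in> lspan W"
      proof (cases "l = 0")
        case False
        \<comment> \<open>After division by \<open>l\<close> the polynomial \<open>f\<close> becomes
          \<open>c + s\<close>. Here \<open>\<Phi>\<close> fixes \<open>s\<close>, whose
          coefficients are in \<open>K\<close>, and moves \<open>c\<close> into \<open>W\<close>; as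
          the image of the sum is in \<open>I\<close>, the difference \<open>s\<close> is in
          \<open>W\<close>.\<close>
        define c where "c = cst (inverse l) * g"
        have "\<Phi> c \<in> W" unfolding c_def by (rule \<Phi>_lspan[OF W(1) lspan_smult[OF g(1)]])
        moreover have "cst (inverse l) * f = c + s"
          using False by (simp add: g(2) c_def distrib_left mult_single flip: mult.assoc)
        then have "\<Phi> c + s \<in> W" using f(2)[of "inverse l"] W(2) by (auto simp: \<Phi>_add \<Phi>_C[OF s])
        moreover have "cst (- 1) * \<Phi> c \<in> W" using \<open>\<Phi> c \<in> W\<close> Ws K_simps(2,5) by blast
        ultimately have "cst (- 1) * \<Phi> c + (\<Phi> c + s) \<in> W" using Ws by blast
        then have "s \<in> W" by (simp add: single_uminus)
        then show ?thesis unfolding g(2) by (intro lspan.add g(1))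
      qed (use g in simp)
      then show ?thesis using IH f(2) by blast
    qed
    then show ?case using sub WW' W \<open>s \<in> W'\<close> by (intro exI[of _ W']) auto
  qed
  moreover define S where "S = (\<lambda>m. Poly_Mapping.single m (1 :: 'l)) ` Poly_Mapping.keys f"
  moreover have "finite S" "S \<subseteq> C" unfolding S_def using monomial_mem_C by auto
  ultimately obtain W where W: "S \<subseteq> W"
    "\<And>f. f \<in> lspan W \<Longrightarrow> (\<And>a. \<Phi> (cst a * f) \<in> I) \<Longrightarrow> f \<in> lspan I"
    by metis
  have "lspan S \<subseteq> lspan W"
    by (rule lspan_min[OF lspan_subspace]) (use W(1) lspan_base in blast)
  then have "f \<in> lspan W" using mem_lspan_monomials[of f] unfolding S_def by blast
  then show ?thesis using W(2) f by blast
qed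

text \<open>The span of \<open>I\<close> is proper because \<open>\<Phi>\<close> fixes 1 and maps
  that span into \<open>I\<close>. A spanning set over \<open>K\<close> still works: a subspace over
  the ambient field meets \<open>C\<close> in a \<open>K\<close>-subspace, which must then be all of
  \<open>C\<close>, and \<open>C\<close> spans everything.\<close>

lemma lspan_zero_dim_ideal: "zero_dim_ideal UNIV (lspan I)"
proof -
  interpret PL: cring "mpoly_ring UNIV :: ('x, 'l) mpoly ring" by (rule mpoly_ring_cring[OF subfield_UNIV])
  have "1 \<notin> lspan I"
    using \<Phi>_ideal[of 1] \<Phi>_C[of 1] one_notin_proper[OF I proper] by auto
  then interpret L: proper_ideal UNIV "lspan I"
    using PL.genideal_ideal[of I] genideal_eq_lspan by (intro proper_ideal.intro subfield_UNIV) auto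
  obtain S where S: "S \<subseteq> C" "finite S" "\<And>V. subspace_over K V \<Longrightarrow> I \<subseteq> V \<Longrightarrow> S \<subseteq> V \<Longrightarrow> V = C"
    using zero_dim unfolding zero_dimensional_iff by blast
  have "V = UNIV" if V: "subspace_over UNIV V" "lspan I \<subseteq> V" "S \<subseteq> V" for V
  proof -
    have "V \<inter> C = C"
    proof (rule S(3))
      show "subspace_over K (V \<inter> C)" using V(1) unfolding subspace_over_def by simp
      show "I \<subseteq> V \<inter> C" using V(2) lspan_base I_closed(2) by blast
    qed (use S V in blast)
    then have "lspan C \<subseteq> V" by (intro lspan_min V(1)) blast
    then show ?thesis using lspan_C by blast
  qed
  then have "zero_dimensional UNIV (lspan I)"
    unfolding L.zero_dimensional_iff using S(2) by (intro exI[of _ S]) auto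
  then show ?thesis
    by (intro zero_dim_ideal.intro L.proper_ideal_axioms zero_dim_ideal_axioms.intro)
qed

sublocale L: zero_dim_ideal UNIV "lspan I"
  by (rule lspan_zero_dim_ideal)

section \<open>Comparison of the filtrations over the two fields\<close>

lemma filt_sub_L: "filt i \<subseteq> L.filt i"
proof
  fix f assume "f \<in> filt i"
  then obtain g where g: "g \<in> F i" "f - g \<in> I" unfolding filt_def by blast
  have "g \<in> L.F i" using g(1) unfolding poly_filt_eq_C L.poly_filt_eq_C by simp
  then show "f \<in> L.filt i" using lspan_base[OF g(2)] unfolding L.filt_def by auto
qed

text \<open>Applying \<open>\<phi>\<close> to coefficients can delete monomials but never creates
  any, so degree bounds persist.\<close>

lemma \<Phi>_filt:
  assumes "f \<in> L.filt i"
  shows "\<Phi> f \<in> filt i"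
proof -
  obtain g where g: "g \<in> L.F i" "f - g \<in> lspan I" using assms unfolding L.filt_def by blast
  have "Poly_Mapping.keys (\<Phi> g) \<subseteq> Poly_Mapping.keys g" by (auto simp: in_keys_iff lookup_\<Phi>)
  then have "\<Phi> g \<in> F i" using g(1) \<Phi>_mem unfolding poly_filt_eq_C L.poly_filt_eq_C by blast
  moreover have "\<Phi> f - \<Phi> g \<in> I" using \<Phi>_ideal[OF g(2)] by (simp add: \<Phi>_diff)
  ultimately show ?thesis unfolding filt_def using \<Phi>_mem by blast
qed

lemma filt_full_iff: "L.filt i = UNIV \<longleftrightarrow> filt i = C"
proof
  assume full: "L.filt i = UNIV"
  have "f \<in> filt i" if "f \<in> C" for f using \<Phi>_filt[of f i] \<Phi>_C[OF that] full by simp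
  then show "filt i = C" using filt_sub by blast
next
  assume "filt i = C"
  then have "lspan C \<subseteq> L.filt i" using filt_sub_L[of i] by (intro lspan_min L.filt_subspace) simp
  then show "L.filt i = UNIV" using lspan_C by blast
qed

text \<open>Both indices are determined by the same threshold condition; hence one filtration step
  can be used for both rings.\<close>

lemma reg_index_lspan: "reg_index UNIV (lspan I) = reg_index K I"
proof -
  have "reg_index UNIV (lspan I) \<le> i \<longleftrightarrow> reg_index K I \<le> i" for i
    unfolding reg_index_le_iff L.reg_index_le_iff using filt_full_iff by simp
  then show ?thesis by (meson order_antisym order_refl)
qed

lemma cayley_bacharach_lspan: "cayley_bacharach K I \<longleftrightarrow> cayley_bacharach UNIV (lspan I)"
proof -
  define r where "r = reg_index K I - 1"
  have "(\<exists>f\<in>C - I. \<forall>g\<in>C. f * g \<in> filt r) \<longleftrightarrow> (\<exists>f\<in>UNIV - lspan I. \<forall>g\<in>UNIV. f * g \<in> L.filt r)"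
  proof
    assume "\<exists>f\<in>C - I. \<forall>g\<in>C. f * g \<in> filt r"
    then obtain f where f: "f \<in> C" "f \<notin> I" "\<And>g. g \<in> C \<Longrightarrow> f * g \<in> filt r" by blast
    have "f \<notin> lspan I" using \<Phi>_ideal[of f] \<Phi>_C[OF f(1)] f(2) by auto
    \<comment> \<open>Only multipliers over \<open>K\<close> are controlled so far; the admissible
      multipliers form a subspace over the ambient field, and \<open>C\<close> spans that whole
      polynomial ring.\<close>
    moreover have "lspan C \<subseteq> {g. f * g \<in> L.filt r}"
    proof (rule lspan_min)
      show "subspace_over UNIV {g. f * g \<in> L.filt r}"
        using L.filt_subspace[of r] by (simp add: subspace_over_def distrib_left) (metis mult.left_commute)
      show "C \<subseteq> {g. f * g \<in> L.filt r}" using f(3) filt_sub_L by blast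
    qed
    then have "\<forall>g. f * g \<in> L.filt r" using lspan_C by blast
    ultimately show "\<exists>f\<in>UNIV - lspan I. \<forall>g\<in>UNIV. f * g \<in> L.filt r" by blast
  next
    assume "\<exists>f\<in>UNIV - lspan I. \<forall>g\<in>UNIV. f * g \<in> L.filt r"
    then obtain f where f: "f \<notin> lspan I" "\<And>g. f * g \<in> L.filt r" by blast
    obtain a where a: "\<Phi> (cst a * f) \<notin> I" using retraction_detects[of f] f(1) by blast
    have "\<Phi> (cst a * f) * g \<in> filt r" if "g \<in> C" for g
    proof -
      \<comment> \<open>The scalar is moved into the multiplier, which is possible because the
        condition on \<open>f\<close> allows every polynomial over the ambient field.\<close>
      have "cst a * f * g \<in> L.filt r" using f(2)[of "cst a * g"] by (simp add: mult_ac)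
      from \<Phi>_filt[OF this] show ?thesis by (simp add: \<Phi>_mult[OF that])
    qed
    then show "\<exists>f\<in>C - I. \<forall>g\<in>C. f * g \<in> filt r" using a \<Phi>_mem by blast
  qed
  then show ?thesis
    unfolding cayley_bacharach_iff L.cayley_bacharach_iff reg_index_lspan r_def by simp
qed

end

theorem corollary4p9:
  fixes K :: "'l::field set" and I :: "('x::finite, 'l) mpoly set"
  assumes "subfield K (ring_of_type_algebra :: 'l ring)"
    and "zero_dimensional K I"
  shows "cayley_bacharach K I \<longleftrightarrow>
    cayley_bacharach (UNIV :: 'l set) (Idl\<^bsub>mpoly_ring (UNIV :: 'l set)\<^esub> I)"
proof -
  have I: "zero_dim_ideal K I"
    using assms by (intro zero_dim_ideal.intro proper_ideal.intro zero_dim_ideal_axioms.intro)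
      (simp_all add: zero_dimensional_def)
  obtain \<phi> :: "'l \<Rightarrow> 'l" where "\<And>a. \<phi> a \<in> K" "\<And>a b. \<phi> (a + b) = \<phi> a + \<phi> b"
    "\<And>k a. k \<in> K \<Longrightarrow> \<phi> (k * a) = k * \<phi> a" "\<phi> 1 = 1"
    using linear_retraction[OF assms(1)] by blast
  then interpret retraction K I \<phi>
    by (intro retraction.intro retraction_axioms.intro I)
  show ?thesis
    using cayley_bacharach_lspan unfolding genideal_eq_lspan .
qed

end
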